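(* For every instance $\mathcal{J}$ of the Weighted Single-Processor Scheduling problem with $n=|\mathcal{J}|$ jobs, the synchronized schedule $\mathcal{S}_{\mathrm{key}}$ defined by the key sequence of $\mathcal{J}$ satisfies $W(\mathcal{S}_{\mathrm{key}})\ge \tfrac12 W(\mathcal{S}_{\mathrm{opt}})$, where $\mathcal{S}_{\mathrm{opt}}$ is an optimal schedule; the key sequence can be computed in $O(n\log n)$ time. Moreover, the bound $1/2$ is tight: for every $\varepsilon>0$ there exists an instance with $W(\mathcal{S}_{\mathrm{key}})<(\tfrac12+\varepsilon)W(\mathcal{S}_{\mathrm{opt}})$.
   Context: Weighted Single-Processor Scheduling: a set $\mathcal{J}$ of $n$ jobs; job $j$ has processing time $p_j>0$ and weight $w_j\ge0$, its own private processor $\mathcal{P}_j$, and there is one shared processor $\mathcal{M}$. A feasible schedule: each job $j$ executes on $\mathcal{P}_j$ in a single interval $(0,C_j^{\mathcal{P}})$ and on $\mathcal{M}$ in a (possibly empty) collection $\mathcal{I}_j$ of open intervals, with $C_j^{\mathcal{P}}+\sum_{I\in\mathcal{I}_j}|I|=p_j$, and all intervals on $\mathcal{M}$ pairwise disjoint. The total overlap $t_j$ is the total time $j$ executes simultaneously on $\mathcal{P}_j$ and $\mathcal{M}$; the total weighted overlap is $W(\mathcal{S})=\sum_j t_jw_j$, and a feasible schedule maximizing it is optimal. For a sequence $(j_1,\ldots,j_k)$ of distinct jobs, the synchronized schedule $(j_1,\ldots,j_k)$ lets $j_i$ execute on $\mathcal{M}$ exactly in $(S_i,C_i)$ where $C_0=0$,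 $S_i=C_{i-1}$, $C_i=(p_{j_i}+S_i)/2$, and on $\mathcal{P}_{j_i}$ in $(0,C_i)$; other jobs run only on their private processors. Key sequence: index the jobs $1,\ldots,n$ so that $p_1\le\cdots\le p_n$, with tied jobs ordered by non-decreasing weight; the key sequence is the (unique) sequence $1\le i_1<\cdots<i_\ell\le n$ with (i) $i_\ell=n$; (ii) $w_{i_1}>\cdots>w_{i_\ell}$; (iii) $w_k\le w_{i_j}$ for each $j\in\{1,\ldots,\ell\}$ and $k\in\{i_{j-1}+1,\ldots,i_j\}$, where $i_0=0$. Then $\mathcal{S}_{\mathrm{key}}$ is the synchronized schedule $(i_1,\ldots,i_\ell)$. *)

theory Defs
  imports "HOL-Analysis.Analysis" "HOL-Library.Landau_Symbols"
begin

section \<open>Weighted single-processor scheduling\<close>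

definition wsps_instance :: "'j set \<Rightarrow> ('j \<Rightarrow> real) \<Rightarrow> ('j \<Rightarrow> real) \<Rightarrow> bool" where
  "wsps_instance J p w \<longleftrightarrow> finite J \<and> (\<forall>j\<in>J. 0 < p j \<and> 0 \<le> w j)"

record 'j schedule =
  private_end :: "'j \<Rightarrow> real"
  shared_intervals :: "'j \<Rightarrow> real set set"

text \<open>
  The collection of intervals of a job is not required to be finite; pairwise disjointness makes it
  countable.  The balance equation is stated with \<open>has_sum\<close> rather than \<open>infsum\<close>, because the latter
  is 0 on divergent families.  In the last clause the family is indexed by pairs of a job and one of
  its intervals, so it covers both two intervals of one job and intervals of different jobs.
\<close>

definition feasible :: "'j set \<Rightarrow> ('j \<Rightarrow> real) \<Rightarrow> 'j schedule \<Rightarrow> bool" where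
  "feasible J p S \<longleftrightarrow>
     (\<forall>j\<in>J. 0 \<le> private_end S j) \<and>
     (\<forall>j\<in>J. \<forall>I\<in>shared_intervals S j. \<exists>a b. 0 \<le> a \<and> a < b \<and> I = {a<..<b}) \<and>
     (\<forall>j\<in>J. \<exists>m. ((\<lambda>I. measure lborel I) has_sum m) (shared_intervals S j) \<and>
                 private_end S j + m = p j) \<and>
     disjoint_family_on snd (SIGMA j:J. shared_intervals S j)"

definition overlap :: "'j schedule \<Rightarrow> 'j \<Rightarrow> real" where
  "overlap S j = measure lborel ({0<..<private_end S j} \<inter> \<Union>(shared_intervals S j))"

definition weighted_overlap :: "'j set \<Rightarrow> ('j \<Rightarrow> real) \<Rightarrow> 'j schedule \<Rightarrow> real" where
  "weighted_overlap J w S = (\<Sum>j\<in>J. overlap S j * w j)"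

definition optimal :: "'j set \<Rightarrow> ('j \<Rightarrow> real) \<Rightarrow> ('j \<Rightarrow> real) \<Rightarrow> 'j schedule \<Rightarrow> bool" where
  "optimal J p w S \<longleftrightarrow> feasible J p S \<and>
     (\<forall>S'. feasible J p S' \<longrightarrow> weighted_overlap J w S' \<le> weighted_overlap J w S)"

section \<open>Synchronized schedules\<close>

text \<open>Lists are indexed from 0, so the \<open>i\<close>-th job of the sequence (counted from 1) is \<open>js ! (i - 1)\<close>
  and it occupies the shared processor from \<open>sync_C p js (i - 1)\<close> to \<open>sync_C p js i\<close>.\<close>

primrec sync_C :: "('j \<Rightarrow> real) \<Rightarrow> 'j list \<Rightarrow> nat \<Rightarrow> real" where
  "sync_C p js 0 = 0"
| "sync_C p js (Suc i) = (p (js ! i) + sync_C p js i) / 2"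

definition sync_schedule :: "('j \<Rightarrow> real) \<Rightarrow> 'j list \<Rightarrow> 'j schedule" where
  "sync_schedule p js =
     \<lparr> private_end = (\<lambda>j. if j \<in> set js
                         then sync_C p js (Suc (THE i. i < length js \<and> js ! i = j))
                         else p j),
       shared_intervals =
         (\<lambda>j. {{sync_C p js i <..< sync_C p js (Suc i)} | i. i < length js \<and> js ! i = j}) \<rparr>"

section \<open>The key sequence\<close>

definition job_indexing ::
  "'j set \<Rightarrow> ('j \<Rightarrow> real) \<Rightarrow> ('j \<Rightarrow> real) \<Rightarrow> (nat \<Rightarrow> 'j) \<Rightarrow> bool" where
  "job_indexing J p w \<sigma> \<longleftrightarrow>
     bij_betw \<sigma> {1..card J} J \<and>
     (\<forall>a\<in>{1..card J}. \<forall>b\<in>{1..card J}. a < b \<longrightarrow>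
        p (\<sigma> a) \<le> p (\<sigma> b) \<and> (p (\<sigma> a) = p (\<sigma> b) \<longrightarrow> w (\<sigma> a) \<le> w (\<sigma> b)))"

text \<open>Prepending 0 implements the convention \<open>i\<^sub>0 = 0\<close>; for \<open>n = 0\<close> the key sequence is empty.\<close>

definition is_key_sequence :: "nat \<Rightarrow> (nat \<Rightarrow> real) \<Rightarrow> nat list \<Rightarrow> bool" where
  "is_key_sequence n v is \<longleftrightarrow>
     set is \<subseteq> {1..n} \<and> sorted_wrt (<) is \<and>
     last (0 # is) = n \<and>
     sorted_wrt (\<lambda>a b. v a > v b) is \<and>
     (\<forall>j<length is. \<forall>k\<in>{(0 # is) ! j + 1 .. is ! j}. v k \<le> v (is ! j))"

definition key_sequence :: "nat \<Rightarrow> (nat \<Rightarrow> real) \<Rightarrow> nat list" where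
  "key_sequence n v = (THE is. is_key_sequence n v is)"

definition key_jobs :: "'j set \<Rightarrow> ('j \<Rightarrow> real) \<Rightarrow> (nat \<Rightarrow> 'j) \<Rightarrow> 'j list" where
  "key_jobs J w \<sigma> = map \<sigma> (key_sequence (card J) (\<lambda>k. w (\<sigma> k)))"

definition key_schedule ::
  "'j set \<Rightarrow> ('j \<Rightarrow> real) \<Rightarrow> ('j \<Rightarrow> real) \<Rightarrow> (nat \<Rightarrow> 'j) \<Rightarrow> 'j schedule" where
  "key_schedule J p w \<sigma> = sync_schedule p (key_jobs J w \<sigma>)"

lemma job_indexing_exists:
  assumes "finite J"
  shows "\<exists>\<sigma>. job_indexing J p w \<sigma>"
  using assms
proof (induction "card J" arbitrary: J)
  case 0
  then show ?case by (auto simp: job_indexing_def bij_betw_def)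
next
  case (Suc n)
  have ne: "J \<noteq> {}" using Suc by auto
  define M where "M = {j\<in>J. p j = Max (p ` J)}"
  have "Max (p ` J) \<in> p ` J" using ne Suc by (intro Max_in) auto
  then have Mne: "M \<noteq> {}" by (auto simp: M_def)
  have finM: "finite M" using Suc by (simp add: M_def)
  have "Max (w ` M) \<in> w ` M" using Mne finM by (intro Max_in) auto
  then obtain x where x: "x \<in> M" "w x = Max (w ` M)" by auto
  have xJ: "x \<in> J" using x by (simp add: M_def)
  have px: "p j \<le> p x" if "j \<in> J" for j using that x Suc by (simp add: M_def)
  have wx: "w j \<le> w x" if "j \<in> J" "p j = p x" for j
    using that x finM by (simp add: M_def)
  have cJ: "card J = Suc n" using Suc by simp
  have card: "card (J - {x}) = n" using xJ cJ Suc.prems by simp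
  obtain \<tau> where \<tau>: "job_indexing (J - {x}) p w \<tau>"
    using Suc.hyps(1)[of "J - {x}"] card Suc.prems by auto
  have bij: "bij_betw \<tau> {1..n} (J - {x})" using \<tau> card by (simp add: job_indexing_def)
  define \<sigma> where "\<sigma> = \<tau>(Suc n := x)"
  have "bij_betw \<sigma> {1..n} (J - {x})" using bij by (subst bij_betw_cong[of _ _ \<tau>]) (auto simp: \<sigma>_def)
  then have "bij_betw \<sigma> ({1..n} \<union> {Suc n}) (J - {x} \<union> {\<sigma> (Suc n)})"
    by (intro notIn_Un_bij_betw) (auto simp: \<sigma>_def)
  moreover have "{1..n} \<union> {Suc n} = {1..Suc n}" by auto
  moreover have "J - {x} \<union> {\<sigma> (Suc n)} = J" using xJ by (auto simp: \<sigma>_def)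
  ultimately have B: "bij_betw \<sigma> {1..Suc n} J" by simp
  have "p (\<sigma> a) \<le> p (\<sigma> b) \<and> (p (\<sigma> a) = p (\<sigma> b) \<longrightarrow> w (\<sigma> a) \<le> w (\<sigma> b))"
    if ab: "a \<in> {1..Suc n}" "b \<in> {1..Suc n}" "a < b" for a b
  proof (cases "b = Suc n")
    case True
    have "\<sigma> a \<in> J" using B ab by (auto simp: bij_betw_def)
    then show ?thesis using px wx True by (simp add: \<sigma>_def)
  next
    case False
    then show ?thesis using \<tau> card ab by (auto simp: job_indexing_def \<sigma>_def)
  qed
  then show ?case using B cJ unfolding job_indexing_def by metis
qed

lemma key_block:
  fixes "is" :: "nat list"
  assumes "last (0 # is) = n" and k: "k \<in> {1..n}"
  shows "\<exists>m. m < length is \<and> (0 # is) ! m < k \<and> k \<le> is ! m"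
proof -
  have ne: "is \<noteq> []" using assms by (cases "is") auto
  let ?P = "\<lambda>m. m < length is \<and> k \<le> is ! m"
  have "?P (length is - 1)" using assms ne by (auto simp: last_conv_nth)
  then have P: "?P (LEAST m. ?P m)" by (rule LeastI)
  define m where "m = (LEAST m. ?P m)"
  have "(0 # is) ! m < k"
  proof (cases m)
    case 0 then show ?thesis using k by auto
  next
    case (Suc m')
    then have "\<not> ?P m'" using not_less_Least[of m' ?P] m_def by auto
    then show ?thesis using Suc P m_def by auto
  qed
  with P m_def show ?thesis by blast
qed

lemma is_key_sequence_set:
  assumes "is_key_sequence n v is"
  shows "set is = {i\<in>{1..n}. \<forall>k\<in>{i<..n}. v k < v i}" (is "_ = ?R")
proof -
  note K = assms[unfolded is_key_sequence_def]
  have lst: "last (0 # is) = n" and sub: "set is \<subseteq> {1..n}"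
    and srt: "sorted_wrt (<) is" and dec: "sorted_wrt (\<lambda>a b. v a > v b) is"
    and blk: "\<And>j k. j < length is \<Longrightarrow> k \<in> {(0 # is) ! j + 1 .. is ! j} \<Longrightarrow> v k \<le> v (is ! j)"
    using K by blast+
  have "i \<in> ?R" if iS: "i \<in> set is" for i
  proof -
    obtain j where j: "j < length is" "i = is ! j" using iS by (metis in_set_conv_nth)
    have "v k < v i" if k: "k \<in> {i<..n}" for k
    proof -
      obtain m where m: "m < length is" "(0 # is) ! m < k" "k \<le> is ! m"
        using key_block[OF lst, of k] k by auto
      have "j < m"
      proof (rule ccontr)
        assume "\<not> j < m"
        then have "is ! m \<le> is ! j"
          using sorted_wrt_nth_less[OF srt, of m j] j by (cases "m = j") auto
        then show False using m k j by auto
      qed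
      then have "v (is ! m) < v i" using dec j m by (auto simp: sorted_wrt_iff_nth_less)
      moreover have "v k \<le> v (is ! m)" using blk[of m k] m by auto
      ultimately show ?thesis by simp
    qed
    then show ?thesis using sub iS by auto
  qed
  moreover have "i \<in> set is" if i: "i \<in> ?R" for i
  proof -
    obtain m where m: "m < length is" "(0 # is) ! m < i" "i \<le> is ! m"
      using key_block[OF lst, of i] i by auto
    have le: "v i \<le> v (is ! m)" using blk[of m i] m by auto
    have "is ! m \<le> n" using sub m nth_mem by fastforce
    have "is ! m = i"
    proof (rule ccontr)
      assume "is ! m \<noteq> i"
      then have "is ! m \<in> {i<..n}" using m \<open>is ! m \<le> n\<close> by simp
      then have "v (is ! m) < v i" using i by blast
      then show False using le by simp
    qed
    then show ?thesis using m nth_mem by blast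
  qed
  ultimately show ?thesis by blast
qed

lemma key_sequence_ex1: "\<exists>!is. is_key_sequence n v is"
proof -
  define R where "R = {i\<in>{1..n}. \<forall>k\<in>{i<..n}. v k < v i}"
  define ks where "ks = sorted_list_of_set R"
  have fin: "finite R" by (simp add: R_def)
  have set: "set ks = R" and srt: "sorted_wrt (<) ks"
    using fin by (auto simp: ks_def)
  have lst: "last (0 # ks) = n"
  proof (cases "n = 0")
    case True then show ?thesis by (simp add: ks_def R_def)
  next
    case False
    then have nR: "n \<in> R" by (auto simp: R_def)
    then have ne: "ks \<noteq> []" using set by auto
    obtain i where i: "i < length ks" "ks ! i = n" using nR set by (metis in_set_conv_nth)
    have "last ks \<in> R" using ne set last_in_set by blast
    then have "last ks \<le> n" by (auto simp: R_def)
    moreover have "n \<le> last ks"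
    proof (cases "i = length ks - 1")
      case False
      then have "i < length ks - 1" using i by linarith
      then show ?thesis
        using sorted_wrt_nth_less[OF srt, of i "length ks - 1"] i ne by (simp add: last_conv_nth)
    qed (use i ne in \<open>simp add: last_conv_nth\<close>)
    ultimately show ?thesis using ne by simp
  qed
  have dec: "sorted_wrt (\<lambda>a b. v a > v b) ks"
    unfolding sorted_wrt_iff_nth_less
  proof (intro allI impI)
    fix i j assume ij: "i < j" "j < length ks"
    then have "ks ! i \<in> R" "ks ! j \<in> R" "ks ! i < ks ! j"
      using set srt by (auto simp: sorted_wrt_iff_nth_less)
    then show "v (ks ! j) < v (ks ! i)" by (auto simp: R_def)
  qed
  have blk: "v k \<le> v (ks ! j)" if j: "j < length ks" and k: "k \<in> {(0 # ks) ! j + 1 .. ks ! j}" for j k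
  proof (rule ccontr)
    assume "\<not> ?thesis"
    then have gt: "v (ks ! j) < v k" by simp
    have jR: "ks ! j \<in> R" using j set nth_mem by blast
    then have jn: "ks ! j \<le> n" by (auto simp: R_def)
    define K where "K = {x\<in>{k..n}. \<forall>y\<in>{k..n}. v y \<le> v x}"
    have "Max (v ` {k..n}) \<in> v ` {k..n}" using k jn by (intro Max_in) auto
    then obtain x where "x \<in> {k..n}" "v x = Max (v ` {k..n})" by auto
    then have "x \<in> K" by (auto simp: K_def intro!: Max_ge)
    moreover have finK: "finite K" by (simp add: K_def)
    ultimately have q: "Max K \<in> K" by (intro Max_in) auto
    define q where "q = Max K"
    have qk: "k \<le> q" "q \<le> n" "v k \<le> v q" using q k jn by (auto simp: K_def q_def)
    have "v y < v q" if y: "y \<in> {q<..n}" for y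
    proof (rule ccontr)
      assume "\<not> ?thesis"
      then have "y \<in> K" using q y qk by (force simp: K_def q_def)
      then have "y \<le> q" using finK by (simp add: q_def)
      then show False using y by simp
    qed
    then have qR: "q \<in> R" using qk k by (auto simp: R_def)
    show False
    proof (cases "q \<le> ks ! j")
      case True
      moreover have "q \<noteq> ks ! j" using gt qk by auto
      ultimately have less: "q < ks ! j" by simp
      obtain i where i: "i < length ks" "q = ks ! i" using qR set by (metis in_set_conv_nth)
      have ij: "i < j"
      proof (rule ccontr)
        assume "\<not> i < j"
        then show False
          using less i sorted_wrt_nth_less[OF srt, of j i] by (cases "i = j") auto
      qed
      then obtain j' where j': "j = Suc j'" using not0_implies_Suc by fastforce
      have "ks ! i \<le> ks ! j'"
        using sorted_wrt_nth_less[OF srt, of i j'] ij j j' by (cases "i = j'") auto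
      then show False using k j' qk i by auto
    next
      case False
      then have "v q < v (ks ! j)" using jR qk by (auto simp: R_def)
      then show False using gt qk by simp
    qed
  qed
  have "is_key_sequence n v ks"
    using set srt lst dec blk unfolding is_key_sequence_def by (auto simp: R_def)
  moreover have "is = ks" if "is_key_sequence n v is" for "is"
  proof (rule strict_sorted_equal)
    show "sorted_wrt (<) is" using that by (simp add: is_key_sequence_def)
    show "set is = set ks" using is_key_sequence_set[OF that] set by (simp add: R_def)
  qed (rule srt)
  ultimately show ?thesis by blast
qed

lemma is_key_sequence_key_sequence: "is_key_sequence n v (key_sequence n v)"
  unfolding key_sequence_def by (rule theI'[OF key_sequence_ex1])

lemma feasible_sync_schedule:
  assumes J: "\<And>j. j \<in> J \<Longrightarrow> 0 < p j" and js: "set js \<subseteq> J" "distinct js"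
    and srt: "sorted_wrt (\<lambda>a b. p a \<le> p b) js"
  shows "feasible J p (sync_schedule p js)"
proof -
  let ?C = "sync_C p js"
  have lt: "0 \<le> ?C i \<and> ?C i < p (js ! i)" if "i < length js" for i
    using that
  proof (induction i)
    case 0
    then have "js ! 0 \<in> J" using js nth_mem by blast
    then show ?case using J by simp
  next
    case (Suc i)
    then have "0 \<le> ?C i" "?C i < p (js ! i)" by auto
    moreover have "p (js ! i) \<le> p (js ! Suc i)"
      using Suc.prems srt by (auto simp: sorted_wrt_iff_nth_less)
    ultimately show ?case by simp
  qed
  have step: "?C i < ?C (Suc i)" if "i < length js" for i using lt[OF that] by simp
  have mono: "?C i \<le> ?C k" if "i \<le> k" "k \<le> length js" for i k
    using that
  proof (induction k)
    case (Suc k)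
    show ?case
    proof (cases "i = Suc k")
      case False
      then have "?C i \<le> ?C k" using Suc by auto
      also have "\<dots> \<le> ?C (Suc k)" using step[of k] Suc.prems by simp
      finally show ?thesis .
    qed simp
  qed simp
  have the: "(THE i. i < length js \<and> js ! i = js ! k) = k" if "k < length js" for k
    using that js(2) by (intro the_equality) (auto simp: nth_eq_iff_index_eq)
  have ivs: "shared_intervals (sync_schedule p js) (js ! k) = {{?C k<..<?C (Suc k)}}"
    if "k < length js" for k
    using that js(2) by (auto simp: sync_schedule_def nth_eq_iff_index_eq simp del: sync_C.simps)
  have iv0: "shared_intervals (sync_schedule p js) j = {}" if "j \<notin> set js" for j
    using that by (auto simp: sync_schedule_def)
  have pe: "private_end (sync_schedule p js) (js ! k) = ?C (Suc k)" if "k < length js" for k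
    using that the[OF that] by (simp add: sync_schedule_def)
  have pe0: "private_end (sync_schedule p js) j = p j" if "j \<notin> set js" for j
    using that by (simp add: sync_schedule_def)
  show ?thesis
    unfolding feasible_def
  proof (intro conjI ballI)
    fix j assume j: "j \<in> J"
    show "0 \<le> private_end (sync_schedule p js) j"
    proof (cases "j \<in> set js")
      case True
      then obtain k where k: "k < length js" "j = js ! k" by (metis in_set_conv_nth)
      show ?thesis
        unfolding k(2) pe[OF k(1)] using lt[OF k(1)] step[OF k(1)] by linarith
    next
      case False then show ?thesis using pe0 J[OF j] by simp
    qed
    show "\<exists>a b. 0 \<le> a \<and> a < b \<and> I = {a<..<b}"
      if I: "I \<in> shared_intervals (sync_schedule p js) j" for I
    proof -
      obtain i where "i < length js" "I = {?C i<..<?C (Suc i)}"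
        using I by (auto simp: sync_schedule_def simp del: sync_C.simps)
      then show ?thesis using lt step by blast
    qed
    show "\<exists>m. ((\<lambda>I. measure lborel I) has_sum m) (shared_intervals (sync_schedule p js) j) \<and>
              private_end (sync_schedule p js) j + m = p j"
    proof (cases "j \<in> set js")
      case True
      then obtain k where k: "k < length js" "j = js ! k" by (metis in_set_conv_nth)
      have "((\<lambda>I. measure lborel I) has_sum (\<Sum>I\<in>{{?C k<..<?C (Suc k)}}. measure lborel I))
              {{?C k<..<?C (Suc k)}}"
        by (rule has_sum_finite) simp
      moreover have "(\<Sum>I\<in>{{?C k<..<?C (Suc k)}}. measure lborel I) = ?C (Suc k) - ?C k"
        using step[OF k(1)] by simp
      moreover have "?C (Suc k) + (?C (Suc k) - ?C k) = p j" using k by (simp add: field_simps)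
      ultimately show ?thesis unfolding k(2) ivs[OF k(1)] pe[OF k(1)] by metis
    next
      case False
      then show ?thesis by (intro exI[of _ 0]) (simp add: iv0 pe0)
    qed
  next
    have disj: "{?C i<..<?C (Suc i)} \<inter> {?C k<..<?C (Suc k)} = {}"
      if "i < k" "k < length js" for i k
      using mono[of "Suc i" k] that by (auto simp del: sync_C.simps)
    show "disjoint_family_on snd (SIGMA j:J. shared_intervals (sync_schedule p js) j)"
      unfolding disjoint_family_on_def
    proof (intro ballI impI)
      fix x y
      assume x: "x \<in> (SIGMA j:J. shared_intervals (sync_schedule p js) j)"
        and y: "y \<in> (SIGMA j:J. shared_intervals (sync_schedule p js) j)" and ne: "x \<noteq> y"
      obtain i where i: "i < length js" "x = (js ! i, {?C i<..<?C (Suc i)})"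
        using x by (auto simp: sync_schedule_def simp del: sync_C.simps)
      obtain k where k: "k < length js" "y = (js ! k, {?C k<..<?C (Suc k)})"
        using y by (auto simp: sync_schedule_def simp del: sync_C.simps)
      have "i \<noteq> k" using ne i k by auto
      then consider "i < k" | "k < i" by linarith
      then show "snd x \<inter> snd y = {}"
        using disj[of i k] disj[of k i] i k by cases (auto simp del: sync_C.simps)
    qed
  qed
qed

lemma feasible_key_schedule:
  assumes "wsps_instance J p w" and \<sigma>: "job_indexing J p w \<sigma>"
  shows "feasible J p (key_schedule J p w \<sigma>)"
proof -
  let ?is = "key_sequence (card J) (\<lambda>k. w (\<sigma> k))"
  have K: "set ?is \<subseteq> {1..card J}" "sorted_wrt (<) ?is"
    using is_key_sequence_key_sequence[of "card J" "\<lambda>k. w (\<sigma> k)"]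
    by (auto simp: is_key_sequence_def)
  have bij: "bij_betw \<sigma> {1..card J} J"
    and mon: "\<And>a b. a \<in> {1..card J} \<Longrightarrow> b \<in> {1..card J} \<Longrightarrow> a < b \<Longrightarrow> p (\<sigma> a) \<le> p (\<sigma> b)"
    using \<sigma> unfolding job_indexing_def by blast+
  show ?thesis
    unfolding key_schedule_def key_jobs_def
  proof (rule feasible_sync_schedule)
    show "0 < p j" if "j \<in> J" for j using assms(1) that by (simp add: wsps_instance_def)
    show "set (map \<sigma> ?is) \<subseteq> J" using K(1) bij by (auto simp: bij_betw_def)
    show "distinct (map \<sigma> ?is)"
      using K bij by (auto simp: distinct_map bij_betw_def strict_sorted_iff intro: inj_on_subset)
    show "sorted_wrt (\<lambda>a b. p a \<le> p b) (map \<sigma> ?is)"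
      unfolding sorted_wrt_map by (rule sorted_wrt_mono_rel[OF _ K(2)]) (use K(1) mon in blast)
  qed
qed

section \<open>Running time\<close>

text \<open>
  A real RAM in structured form.  The machine has variables and unbounded arrays holding natural
  numbers (used as indices and counters), and variables and unbounded arrays holding reals, on which
  it can do arithmetic and comparisons (no rounding).  Uniform cost: every node of an evaluated
  expression and every executed command costs one unit of time.
\<close>

datatype nexp = NConst nat | NVar string | NArr string nexp | NAdd nexp nexp | NSub nexp nexp

datatype rexp = RConst int | RVar string | RArr string nexp
  | RAdd rexp rexp | RSub rexp rexp | RMul rexp rexp | RDiv rexp rexp

datatype bexp = NLess nexp nexp | RLess rexp rexp | BNot bexp | BAnd bexp bexp

datatype com = Skip
  | NAssign string nexp
  | NUpdate string nexp nexp
  | RAssign string rexp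
  | RUpdate string nexp rexp
  | Seq com com
  | Cond bexp com com
  | While bexp com

record state =
  nvar :: "string \<Rightarrow> nat"
  narr :: "string \<Rightarrow> nat \<Rightarrow> nat"
  rvar :: "string \<Rightarrow> real"
  rarr :: "string \<Rightarrow> nat \<Rightarrow> real"

primrec nval :: "state \<Rightarrow> nexp \<Rightarrow> nat" where
  "nval s (NConst c) = c"
| "nval s (NVar x) = nvar s x"
| "nval s (NArr a e) = narr s a (nval s e)"
| "nval s (NAdd e f) = nval s e + nval s f"
| "nval s (NSub e f) = nval s e - nval s f"

primrec rval :: "state \<Rightarrow> rexp \<Rightarrow> real" where
  "rval s (RConst c) = real_of_int c"
| "rval s (RVar x) = rvar s x"
| "rval s (RArr a e) = rarr s a (nval s e)"
| "rval s (RAdd e f) = rval s e + rval s f"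
| "rval s (RSub e f) = rval s e - rval s f"
| "rval s (RMul e f) = rval s e * rval s f"
| "rval s (RDiv e f) = rval s e / rval s f"

primrec bval :: "state \<Rightarrow> bexp \<Rightarrow> bool" where
  "bval s (NLess e f) \<longleftrightarrow> nval s e < nval s f"
| "bval s (RLess e f) \<longleftrightarrow> rval s e < rval s f"
| "bval s (BNot b) \<longleftrightarrow> \<not> bval s b"
| "bval s (BAnd b c) \<longleftrightarrow> bval s b \<and> bval s c"

primrec ncost :: "nexp \<Rightarrow> nat" where
  "ncost (NConst c) = 1"
| "ncost (NVar x) = 1"
| "ncost (NArr a e) = 1 + ncost e"
| "ncost (NAdd e f) = 1 + ncost e + ncost f"
| "ncost (NSub e f) = 1 + ncost e + ncost f"

primrec rcost :: "rexp \<Rightarrow> nat" where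
  "rcost (RConst c) = 1"
| "rcost (RVar x) = 1"
| "rcost (RArr a e) = 1 + ncost e"
| "rcost (RAdd e f) = 1 + rcost e + rcost f"
| "rcost (RSub e f) = 1 + rcost e + rcost f"
| "rcost (RMul e f) = 1 + rcost e + rcost f"
| "rcost (RDiv e f) = 1 + rcost e + rcost f"

primrec bcost :: "bexp \<Rightarrow> nat" where
  "bcost (NLess e f) = 1 + ncost e + ncost f"
| "bcost (RLess e f) = 1 + rcost e + rcost f"
| "bcost (BNot b) = 1 + bcost b"
| "bcost (BAnd b c) = 1 + bcost b + bcost c"

text \<open>\<open>exec c s t s'\<close>: command \<open>c\<close> started in \<open>s\<close> terminates in \<open>s'\<close> after \<open>t\<close> units of time.\<close>

inductive exec :: "com \<Rightarrow> state \<Rightarrow> nat \<Rightarrow> state \<Rightarrow> bool" where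
  Skip: "exec Skip s 1 s"
| NAssign: "exec (NAssign x e) s (1 + ncost e) (s\<lparr>nvar := (nvar s)(x := nval s e)\<rparr>)"
| NUpdate: "exec (NUpdate a i e) s (1 + ncost i + ncost e)
     (s\<lparr>narr := (narr s)(a := (narr s a)(nval s i := nval s e))\<rparr>)"
| RAssign: "exec (RAssign x e) s (1 + rcost e) (s\<lparr>rvar := (rvar s)(x := rval s e)\<rparr>)"
| RUpdate: "exec (RUpdate a i e) s (1 + ncost i + rcost e)
     (s\<lparr>rarr := (rarr s)(a := (rarr s a)(nval s i := rval s e))\<rparr>)"
| Seq: "exec c s t s' \<Longrightarrow> exec d s' u s'' \<Longrightarrow> exec (Seq c d) s (1 + t + u) s''"
| CondTrue: "bval s b \<Longrightarrow> exec c s t s' \<Longrightarrow> exec (Cond b c d) s (1 + bcost b + t) s'"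
| CondFalse: "\<not> bval s b \<Longrightarrow> exec d s t s' \<Longrightarrow> exec (Cond b c d) s (1 + bcost b + t) s'"
| WhileFalse: "\<not> bval s b \<Longrightarrow> exec (While b c) s (1 + bcost b) s"
| WhileTrue: "bval s b \<Longrightarrow> exec c s t s' \<Longrightarrow> exec (While b c) s' u s'' \<Longrightarrow>
     exec (While b c) s (1 + bcost b + t + u) s''"

text \<open>
  An instance with job set \<open>{..<n}\<close>, the jobs being in arbitrary order, is given by the number \<open>n\<close>
  and the arrays of processing times and weights; all other memory is zero.
\<close>

definition input_state :: "nat \<Rightarrow> (nat \<Rightarrow> real) \<Rightarrow> (nat \<Rightarrow> real) \<Rightarrow> state" where
  "input_state n p w =
     \<lparr> nvar = (\<lambda>_. 0)(''n'' := n),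
       narr = (\<lambda>_ _. 0),
       rvar = (\<lambda>_. 0),
       rarr = (\<lambda>_ _. 0)(''p'' := (\<lambda>i. if i < n then p i else 0),
                         ''w'' := (\<lambda>i. if i < n then w i else 0)) \<rparr>"

definition output_list :: "state \<Rightarrow> nat list" where
  "output_list s = map (narr s ''key'') [0..<nvar s ''len'']"

text \<open>Jobs that agree in both processing time and weight may be indexed in either order, so the
  program is free to choose among the admissible indexings.\<close>

definition computes_key_sequence :: "com \<Rightarrow> (nat \<Rightarrow> nat) \<Rightarrow> bool" where
  "computes_key_sequence c T \<longleftrightarrow>
     (\<forall>n p w. wsps_instance {..<n} p w \<longrightarrow>
        (\<exists>t s. exec c (input_state n p w) t s \<and> t \<le> T n \<and>
           (\<exists>\<sigma>. job_indexing {..<n} p w \<sigma> \<and> output_list s = key_jobs {..<n} w \<sigma>)))"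

end

theory Submission
  imports Defs "HOL-Real_Asymp.Real_Asymp"
begin

text \<open>
  Let \<open>u\<^sub>1 > \<dots> > u\<^sub>l\<close> be the weights and \<open>q\<^sub>1 \<le> \<dots> \<le> q\<^sub>l\<close> the processing times of the key jobs, and
  put \<open>u\<^sub>l\<^sub>+\<^sub>1 = 0\<close>.  In a feasible schedule the jobs up to the \<open>k\<close>-th key job overlap in disjoint subsets
  of \<open>(0, q\<^sub>k)\<close>, so its value is at most the sum of the \<open>(u\<^sub>k - u\<^sub>k\<^sub>+\<^sub>1) q\<^sub>k\<close>, while the key schedule has
  value equal to the sum of the \<open>(u\<^sub>k - u\<^sub>k\<^sub>+\<^sub>1) C\<^sub>k\<close> with \<open>C\<^sub>k \<ge> q\<^sub>k / 2\<close>.  For \<open>n\<close> jobs of processing time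
  and weight 1 the key schedule has value \<open>1/2\<close>, and synchronizing all jobs gives \<open>1 - 2\<^sup>-\<^sup>n\<close>.  An optimal
  schedule exists because the attainable overlap vectors form a finite union of compact polytopes, one
  for each order of the private completion times.  The key sequence consists of the strict suffix maxima
  of the weights after sorting the jobs, and a stack finds these in linear time.
\<close>

section \<open>Overlaps of feasible schedules\<close>

text \<open>Carries the \<open>has_sum\<close> of the balance equation over to Lebesgue measure,
  also for infinite collections: nonnegative summable families are absolutely summable, and their
  sum is an integral over the counting measure, where countable additivity applies.\<close>

lemma measure_Union_has_sum:
  assumes "countable F" "disjoint F" "\<And>X. X \<in> F \<Longrightarrow> X \<in> fmeasurable M"
    and sum: "((\<lambda>X. measure M X) has_sum m) F"
  shows "emeasure M (\<Union>F) = ennreal m"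
proof -
  have "(\<lambda>X. norm (measure M X)) summable_on F"
    using sum by (auto intro: has_sum_imp_summable)
  then have abs: "Infinite_Set_Sum.abs_summable_on (\<lambda>X. measure M X) F"
    using abs_summable_equivalent by blast
  have "emeasure M (\<Union>F) = (\<integral>\<^sup>+X. emeasure M X \<partial>count_space F)"
    using emeasure_UN_countable[of F "\<lambda>X. X" M] assms
    by (auto simp: disjoint_family_on_def disjoint_def)
  also have "\<dots> = (\<integral>\<^sup>+X. ennreal (measure M X) \<partial>count_space F)"
    using assms(3) by (intro nn_integral_cong) (auto simp: emeasure_eq_measure2)
  also have "\<dots> = ennreal (infsetsum (\<lambda>X. measure M X) F)"
    by (rule nn_integral_conv_infsetsum[OF abs]) simp
  also have "infsetsum (\<lambda>X. measure M X) F = m"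
    using infsetsum_infsum[OF abs] infsumI[OF sum] by simp
  finally show ?thesis .
qed

text \<open>The overlap is part of the shared time of the job, which by the balance equation has
  measure \<open>p j - private_end S j\<close>.\<close>

lemma feasible_overlap_le:
  assumes S: "feasible J p S" and j: "j \<in> J"
  shows "overlap S j + private_end S j \<le> p j"
proof -
  let ?F = "shared_intervals S j"
  have iv: "\<exists>a b. 0 \<le> a \<and> a < b \<and> I = {a<..<b}" if "I \<in> ?F" for I
    using S j that unfolding feasible_def by blast
  obtain m where m: "((\<lambda>I. measure lborel I) has_sum m) ?F" "private_end S j + m = p j"
    using S j unfolding feasible_def by blast
  have disj: "disjoint ?F"
    unfolding disjoint_def
  proof (intro ballI impI)
    fix X Y assume "X \<in> ?F" "Y \<in> ?F" "X \<noteq> Y"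
    then show "X \<inter> Y = {}"
      using S j disjoint_family_onD[of snd "SIGMA j:J. shared_intervals S j" "(j, X)" "(j, Y)"]
      unfolding feasible_def by auto
  qed
  have op: "open X" if "X \<in> ?F" for X using iv[OF that] by auto
  \<comment> \<open>Disjoint open subsets of the line form a countable family.\<close>
  have cnt: "countable ?F"
    using op disj by (intro countable_disjoint_open_subsets) auto
  have fm: "X \<in> fmeasurable lborel" if "X \<in> ?F" for X
    using iv[OF that] by (auto simp: fmeasurable_def)
  have eq: "emeasure lborel (\<Union>?F) = ennreal m"
    by (rule measure_Union_has_sum[OF cnt disj fm m(1)])
  have m0: "0 \<le> m" using m(1) by (rule has_sum_nonneg) simp
  have sets: "\<Union>?F \<in> sets lborel" using op by (simp add: borel_open open_Union)
  have "overlap S j \<le> measure lborel (\<Union>?F)"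
    unfolding overlap_def using sets eq
    by (intro measure_mono_fmeasurable) (auto simp: fmeasurable_def)
  also have "\<dots> = m" using eq m0 by (simp add: measure_def)
  finally show ?thesis using m by simp
qed

lemma overlap_nonneg: "0 \<le> overlap S j"
  by (simp add: overlap_def)

lemma feasible_private_end_le:
  assumes "feasible J p S" "j \<in> J"
  shows "private_end S j \<le> p j"
  using feasible_overlap_le[OF assms] overlap_nonneg[of S j] by simp

text \<open>The shared processor serves one job at a time, so the overlap sets of distinct jobs are
  disjoint, and all of them lie in \<open>(0, b)\<close>.\<close>

lemma sum_overlap_le:
  assumes S: "feasible J p S" and K: "finite K" "K \<subseteq> J"
    and le: "\<And>j. j \<in> K \<Longrightarrow> private_end S j \<le> b" and b: "0 \<le> b"
  shows "(\<Sum>j\<in>K. overlap S j) \<le> b"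
proof -
  let ?A = "\<lambda>j. {0<..<private_end S j} \<inter> \<Union>(shared_intervals S j)"
  have iv: "\<exists>a b. I = {a<..<b}" if "j \<in> J" "I \<in> shared_intervals S j" for I j
    using S that unfolding feasible_def by blast
  have "open (?A j)" if "j \<in> K" for j
    using iv[of j] that K by (intro open_Int open_Union) fastforce+
  then have sets: "?A ` K \<subseteq> sets lborel" by auto
  have disj: "disjoint_family_on ?A K"
    unfolding disjoint_family_on_def
  proof (intro ballI impI)
    fix i j assume ij: "i \<in> K" "j \<in> K" "i \<noteq> j"
    have "X \<inter> Y = {}" if "X \<in> shared_intervals S i" "Y \<in> shared_intervals S j" for X Y
      using S K ij that
        disjoint_family_onD[of snd "SIGMA j:J. shared_intervals S j" "(i, X)" "(j, Y)"]
      unfolding feasible_def by auto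
    then show "?A i \<inter> ?A j = {}" by blast
  qed
  have fin: "emeasure lborel (?A j) \<noteq> \<infinity>" if "j \<in> K" for j
  proof -
    have "emeasure lborel (?A j) \<le> emeasure lborel {0<..<private_end S j}"
      by (rule emeasure_mono) auto
    also have "\<dots> < \<infinity>" using S K that by (subst emeasure_lborel_Ioo) (auto simp: feasible_def)
    finally show ?thesis by simp
  qed
  have "(\<Sum>j\<in>K. overlap S j) = measure lborel (\<Union>j\<in>K. ?A j)"
    unfolding overlap_def using measure_finite_Union[OF K(1) sets disj fin] by simp
  also have "\<dots> \<le> measure lborel {0<..<b}"
  proof (rule measure_mono_fmeasurable)
    show "(\<Union>j\<in>K. ?A j) \<subseteq> {0<..<b}" using le by fastforce
    show "(\<Union>j\<in>K. ?A j) \<in> sets lborel" using sets K(1) by (intro sets.finite_UN) auto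
    show "{0<..<b} \<in> fmeasurable lborel" using b by (simp add: fmeasurable_def)
  qed
  also have "\<dots> = b" using b by simp
  finally show ?thesis .
qed

section \<open>Existence of optimal schedules\<close>

text \<open>The overlap vectors of schedules in which the jobs use the shared processor in the order \<open>js\<close>:
  job \<open>js ! k\<close> must complete its overlap before its private processor stops at \<open>p (js ! k) - t (js ! k)\<close>.\<close>

definition overlap_polytope :: "('j \<Rightarrow> real) \<Rightarrow> 'j list \<Rightarrow> ('j \<Rightarrow> real) set" where
  "overlap_polytope p js = {t. (\<forall>j. 0 \<le> t j) \<and> (\<forall>j. j \<notin> set js \<longrightarrow> t j = 0) \<and>
     (\<forall>k<length js. (\<Sum>i<k. t (js ! i)) + 2 * t (js ! k) \<le> p (js ! k))}"

text \<open>Let \<open>js\<close> list the jobs by private completion time. The overlaps of the jobs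
  up to \<open>js ! k\<close> all fit before \<open>private_end S (js ! k)\<close>, which is at most
  the processing time of that job minus its overlap; this explains the factor 2.\<close>

lemma feasible_imp_overlap_polytope:
  assumes S: "feasible J p S" and fin: "finite J"
  obtains js where "distinct js" "set js = J"
    "(\<lambda>j. if j \<in> J then overlap S j else 0) \<in> overlap_polytope p js"
proof -
  obtain xs where xs: "set xs = J" "distinct xs" using finite_distinct_list[OF fin] by blast
  define js where "js = sort_key (private_end S) xs"
  have js: "set js = J" "distinct js" using xs by (auto simp: js_def)
  have srt: "private_end S (js ! i) \<le> private_end S (js ! k)" if "i \<le> k" "k < length js" for i k
    using that sorted_sort_key[of "private_end S" xs]
    by (auto simp: js_def sorted_iff_nth_mono simp del: sorted_sort_key)
  let ?t = "\<lambda>j. if j \<in> J then overlap S j else 0"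
  have "(\<Sum>i<k. ?t (js ! i)) + 2 * ?t (js ! k) \<le> p (js ! k)" if k: "k < length js" for k
  proof -
    have mem: "js ! i \<in> J" if "i \<le> k" for i using js k that by (metis nth_mem order_le_less_trans)
    let ?K = "(\<lambda>i. js ! i) ` {..k}"
    have inj: "inj_on (\<lambda>i. js ! i) {..k}"
      using js k by (auto simp: inj_on_def nth_eq_iff_index_eq)
    have "(\<Sum>i<k. ?t (js ! i)) + ?t (js ! k) = (\<Sum>i\<le>k. overlap S (js ! i))"
      using mem by (simp add: lessThan_Suc_atMost[symmetric])
    also have "\<dots> = (\<Sum>j\<in>?K. overlap S j)" using sum.reindex[OF inj, of "overlap S"] by simp
    also have "\<dots> \<le> private_end S (js ! k)"
      using S mem srt[OF _ k] mem[of k] by (intro sum_overlap_le[OF S]) (auto simp: feasible_def)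
    finally show ?thesis using feasible_overlap_le[OF S mem[of k]] mem[of k] by simp
  qed
  then have "?t \<in> overlap_polytope p js"
    using js by (auto simp: overlap_polytope_def overlap_nonneg)
  then show ?thesis using that js by blast
qed

text \<open>The jobs run back to back on the shared processor. The \<open>k\<close>-th constraint
  says that the interval from \<open>P k\<close> to \<open>P (Suc k)\<close> ends before the private
  processor stops, so all of it counts as overlap.\<close>

lemma overlap_polytope_imp_feasible:
  assumes t: "t \<in> overlap_polytope p js" and js: "distinct js"
  shows "\<exists>S. feasible (set js) p S \<and> (\<forall>j\<in>set js. overlap S j = t j)"
proof -
  define P where "P k = (\<Sum>i<k. t (js ! i))" for k
  \<comment> \<open>The guard \<open>0 < t j\<close> drops degenerate intervals, since
    \<open>feasible\<close> demands \<open>a < b\<close>.\<close>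
  define S where "S = \<lparr>private_end = (\<lambda>j. p j - t j),
    shared_intervals = (\<lambda>j. {{P k<..<P (Suc k)} | k. k < length js \<and> js ! k = j \<and> 0 < t j})\<rparr>"
  have t0: "0 \<le> t j" for j using t by (simp add: overlap_polytope_def)
  have c: "P k + 2 * t (js ! k) \<le> p (js ! k)" if "k < length js" for k
    using t that by (simp add: overlap_polytope_def P_def)
  have PS: "P (Suc k) = P k + t (js ! k)" for k by (simp add: P_def)
  have P0: "0 \<le> P k" for k by (simp add: P_def t0 sum_nonneg)
  have "mono P" by (rule incseq_SucI) (simp add: PS t0)
  then have mono: "P i \<le> P k" if "i \<le> k" for i k using that by (rule monoD)
  have iv: "shared_intervals S (js ! k) = (if 0 < t (js ! k) then {{P k<..<P (Suc k)}} else {})"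
    if "k < length js" for k
    using that js by (auto simp: S_def nth_eq_iff_index_eq)
  have "feasible (set js) p S"
    unfolding feasible_def
  proof (intro conjI ballI)
    fix j assume "j \<in> set js"
    then obtain k where k: "k < length js" "j = js ! k" by (metis in_set_conv_nth)
    show "0 \<le> private_end S j"
      using c[OF k(1)] P0[of k] t0[of "js ! k"] unfolding k(2) by (simp add: S_def)
    show "\<exists>a b. 0 \<le> a \<and> a < b \<and> I = {a<..<b}" if "I \<in> shared_intervals S j" for I
      using that P0[of k] PS[of k] iv[OF k(1)] k(2)
      by (intro exI[of _ "P k"] exI[of _ "P (Suc k)"]) (auto split: if_splits)
    have "((\<lambda>I. measure lborel I) has_sum (\<Sum>I\<in>shared_intervals S j. measure lborel I))
        (shared_intervals S j)"
      by (rule has_sum_finite) (simp add: k iv[OF k(1)])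
    moreover have "(\<Sum>I\<in>shared_intervals S j. measure lborel I) = t j"
      using t0[of j] by (auto simp: k iv[OF k(1)] PS)
    moreover have "private_end S j + t j = p j" by (simp add: S_def)
    ultimately show "\<exists>m. ((\<lambda>I. measure lborel I) has_sum m) (shared_intervals S j) \<and>
        private_end S j + m = p j"
      by metis
  next
    have disj: "{P i<..<P (Suc i)} \<inter> {P k<..<P (Suc k)} = {}" if "i < k" for i k
      using mono[of "Suc i" k] that by auto
    show "disjoint_family_on snd (SIGMA j:set js. shared_intervals S j)"
      unfolding disjoint_family_on_def
    proof (intro ballI impI)
      fix x y
      assume x: "x \<in> (SIGMA j:set js. shared_intervals S j)"
        and y: "y \<in> (SIGMA j:set js. shared_intervals S j)" and ne: "x \<noteq> y"
      obtain i where i: "i < length js" "x = (js ! i, {P i<..<P (Suc i)})"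
        using x by (auto simp: S_def)
      obtain k where k: "k < length js" "y = (js ! k, {P k<..<P (Suc k)})"
        using y by (auto simp: S_def)
      have "i \<noteq> k" using ne i k by auto
      then consider "i < k" | "k < i" by linarith
      then show "snd x \<inter> snd y = {}"
        using disj[of i k] disj[of k i] i k by cases auto
    qed
  qed
  moreover have "overlap S j = t j" if j: "j \<in> set js" for j
  proof -
    obtain k where k: "k < length js" "j = js ! k" using j by (metis in_set_conv_nth)
    show ?thesis
    proof (cases "0 < t j")
      case True
      have "{0<..<private_end S j} \<inter> \<Union>(shared_intervals S j) = {P k<..<P (Suc k)}"
        using True c[OF k(1)] P0[of k] k PS[of k] by (auto simp: iv[OF k(1)]) (auto simp: S_def)
      then show ?thesis using k t0[of j] by (simp add: overlap_def PS)
    next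
      case False
      then show ?thesis using t0[of j] by (simp add: overlap_def k iv[OF k(1)])
    qed
  qed
  ultimately show ?thesis by blast
qed

text \<open>Overlap vectors are functions on the whole, possibly infinite, job type. The polytope is
  closed and lies in a product of compact intervals, which is compact by Tychonoff's
  theorem.\<close>

lemma compact_overlap_polytope: "compact (overlap_polytope p js)"
proof -
  have cont: "continuous_on UNIV (\<lambda>t::'a \<Rightarrow> real. t j)" for j by simp
  \<comment> \<open>The absolute value keeps 0 inside the box even where \<open>p\<close> is
    negative.\<close>
  have sub: "overlap_polytope p js \<subseteq> PiE UNIV (\<lambda>j. {0..\<bar>p j\<bar>})"
  proof (intro subsetI PiE_I)
    fix t j assume t: "t \<in> overlap_polytope p js"
    have t0: "0 \<le> t i" for i using t by (simp add: overlap_polytope_def)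
    show "t j \<in> {0..\<bar>p j\<bar>}"
    proof (cases "j \<in> set js")
      case True
      then obtain k where k: "k < length js" "j = js ! k" by (metis in_set_conv_nth)
      then have "(\<Sum>i<k. t (js ! i)) + 2 * t j \<le> p j" using t by (simp add: overlap_polytope_def)
      moreover have "0 \<le> (\<Sum>i<k. t (js ! i))" by (simp add: t0 sum_nonneg)
      ultimately show ?thesis using t0[of j] by (simp)
    next
      case False then show ?thesis using t by (simp add: overlap_polytope_def)
    qed
  qed simp
  have "closed (overlap_polytope p js)"
    unfolding overlap_polytope_def
    by (intro closed_Collect_conj closed_Collect_all closed_Collect_imp closed_Collect_le
        closed_Collect_eq continuous_intros cont open_Collect_const)
  moreover have "compact (PiE UNIV (\<lambda>j. {0..\<bar>p j\<bar>}))"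
  proof -
    have "compactin (product_topology (\<lambda>_. euclidean) UNIV) (PiE UNIV (\<lambda>j. {0..\<bar>p j\<bar>}))"
      by (subst compactin_PiE) auto
    then show ?thesis by (simp add: euclidean_product_topology)
  qed
  ultimately show ?thesis using sub compact_Int_closed by (metis inf.absorb_iff2)
qed

text \<open>The linear objective \<open>f\<close> attains its maximum on the compact set
  \<open>V\<close>. Every feasible schedule has its overlap vector in \<open>V\<close>, and the
  maximizer is realized by a feasible schedule.\<close>

lemma optimal_exists:
  assumes inst: "wsps_instance J p w"
  shows "\<exists>S. optimal J p w S"
proof -
  have fin: "finite J" and pos: "\<And>j. j \<in> J \<Longrightarrow> 0 < p j"
    using inst by (auto simp: wsps_instance_def)
  define L where "L = {js. distinct js \<and> set js = J}"
  define V where "V = (\<Union>js\<in>L. overlap_polytope p js)"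
  define f where "f t = (\<Sum>j\<in>J. t j * w j)" for t
  have "L \<subseteq> {js. set js \<subseteq> J \<and> length js = card J}"
    by (auto simp: L_def distinct_card)
  then have "finite L" using finite_lists_length_eq[OF fin] finite_subset by blast
  then have "compact V" unfolding V_def by (intro compact_UN compact_overlap_polytope)
  moreover obtain js where js: "js \<in> L" using finite_distinct_list[OF fin] by (auto simp: L_def)
  have "(\<lambda>_. 0) \<in> overlap_polytope p js"
    using js pos nth_mem by (force simp: overlap_polytope_def L_def intro: less_imp_le)
  then have "V \<noteq> {}" using js by (auto simp: V_def)
  moreover have "continuous_on UNIV f"
    unfolding f_def by (intro continuous_intros continuous_on_product_coordinates)
  then have "continuous_on V f" using continuous_on_subset by blast
  ultimately obtain t where t: "t \<in> V" "\<And>u. u \<in> V \<Longrightarrow> f u \<le> f t"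
    using continuous_attains_sup[of V f] by blast
  obtain js where js: "js \<in> L" "t \<in> overlap_polytope p js" using t by (auto simp: V_def)
  obtain S where S: "feasible J p S" "\<And>j. j \<in> J \<Longrightarrow> overlap S j = t j"
    using overlap_polytope_imp_feasible[OF js(2)] js(1) by (auto simp: L_def)
  have "weighted_overlap J w S' \<le> weighted_overlap J w S" if S': "feasible J p S'" for S'
  proof -
    let ?u = "\<lambda>j. if j \<in> J then overlap S' j else 0"
    obtain js where "distinct js" "set js = J" "?u \<in> overlap_polytope p js"
      using feasible_imp_overlap_polytope[OF S' fin] by blast
    then have "?u \<in> V" by (auto simp: V_def L_def)
    then have "f ?u \<le> f t" by (rule t)
    then show ?thesis using S by (simp add: weighted_overlap_def f_def)
  qed
  then show ?thesis using S by (auto simp: optimal_def)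
qed

section \<open>The approximation guarantee\<close>

text \<open>Each completion time is the midpoint of the previous one and the processing time of the
  job, so it stays below this processing time and hence below the next one.\<close>

lemma sync_C_bounds:
  assumes J: "\<And>j. j \<in> set js \<Longrightarrow> 0 < p j" and srt: "sorted_wrt (\<lambda>a b. p a \<le> p b) js"
    and i: "i < length js"
  shows "0 \<le> sync_C p js i \<and> sync_C p js i < p (js ! i)"
  using i
proof (induction i)
  case 0
  then show ?case using J by simp
next
  case (Suc i)
  then have "0 \<le> sync_C p js i" "sync_C p js i < p (js ! i)" by auto
  moreover have "p (js ! i) \<le> p (js ! Suc i)"
    using Suc.prems srt by (auto simp: sorted_wrt_iff_nth_less)
  ultimately show ?case by simp
qed

text \<open>Private and shared execution of a job of \<open>js\<close> end together, so its whole
  shared interval is overlap.\<close>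

lemma weighted_overlap_sync_schedule:
  assumes pos: "\<And>j. j \<in> set js \<Longrightarrow> 0 < p j" and srt: "sorted_wrt (\<lambda>a b. p a \<le> p b) js"
    and js: "distinct js" "set js \<subseteq> J" and fin: "finite J"
  shows "weighted_overlap J w (sync_schedule p js) =
    (\<Sum>k<length js. w (js ! k) * (sync_C p js (Suc k) - sync_C p js k))"
proof -
  let ?C = "sync_C p js" and ?S = "sync_schedule p js"
  have "overlap ?S j = 0" if "j \<notin> set js" for j
  proof -
    have "shared_intervals ?S j = {}" using that by (auto simp: sync_schedule_def)
    then show ?thesis by (simp add: overlap_def)
  qed
  then have "weighted_overlap J w ?S = (\<Sum>j\<in>set js. overlap ?S j * w j)"
    unfolding weighted_overlap_def using js fin by (intro sum.mono_neutral_right) auto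
  also have "\<dots> = (\<Sum>k<length js. overlap ?S (js ! k) * w (js ! k))"
    using js(1) by (intro sum.reindex_bij_betw[symmetric] bij_betw_nth) auto
  also have "\<dots> = (\<Sum>k<length js. w (js ! k) * (?C (Suc k) - ?C k))"
  proof (intro sum.cong refl)
    fix k assume "k \<in> {..<length js}"
    then have k: "k < length js" by simp
    have b: "0 \<le> ?C k" "?C k < ?C (Suc k)" using sync_C_bounds[OF pos srt k] by auto
    have the: "(THE i. i < length js \<and> js ! i = js ! k) = k"
      using k js(1) by (intro the_equality) (auto simp: nth_eq_iff_index_eq)
    have iv: "shared_intervals ?S (js ! k) = {{?C k<..<?C (Suc k)}}"
      using k js(1) by (auto simp: sync_schedule_def nth_eq_iff_index_eq simp del: sync_C.simps)
    have pe: "private_end ?S (js ! k) = ?C (Suc k)"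
      using k the by (simp add: sync_schedule_def)
    have "{0<..<?C (Suc k)} \<inter> {?C k<..<?C (Suc k)} = {?C k<..<?C (Suc k)}"
      using b by (auto simp del: sync_C.simps)
    then have "overlap ?S (js ! k) = ?C (Suc k) - ?C k"
      unfolding overlap_def iv pe using b by (simp del: sync_C.simps)
    then show "overlap ?S (js ! k) * w (js ! k) = w (js ! k) * (?C (Suc k) - ?C k)" by simp
  qed
  finally show ?thesis .
qed

text \<open>Abel summation. In \<open>key_schedule_half\<close> the boundary terms vanish because
  \<open>u l = 0\<close> and \<open>C 0 = 0\<close>.\<close>

lemma sum_by_parts:
  fixes u C :: "nat \<Rightarrow> 'a::comm_ring"
  shows "(\<Sum>k<N. u k * (C (Suc k) - C k)) =
    (\<Sum>k<N. (u k - u (Suc k)) * C (Suc k)) + u N * C N - u 0 * C 0"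
  by (induction N) (auto simp: algebra_simps)

lemma key_jobs_props:
  assumes \<sigma>: "job_indexing J p w \<sigma>"
  shows "set (key_jobs J w \<sigma>) \<subseteq> J" "distinct (key_jobs J w \<sigma>)"
    "sorted_wrt (\<lambda>a b. p a \<le> p b) (key_jobs J w \<sigma>)"
proof -
  let ?is = "key_sequence (card J) (\<lambda>k. w (\<sigma> k))"
  have K: "set ?is \<subseteq> {1..card J}" "sorted_wrt (<) ?is"
    using is_key_sequence_key_sequence[of "card J" "\<lambda>k. w (\<sigma> k)"]
    by (auto simp: is_key_sequence_def)
  have bij: "bij_betw \<sigma> {1..card J} J"
    and mon: "\<And>a b. a \<in> {1..card J} \<Longrightarrow> b \<in> {1..card J} \<Longrightarrow> a < b \<Longrightarrow> p (\<sigma> a) \<le> p (\<sigma> b)"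
    using \<sigma> unfolding job_indexing_def by blast+
  show "set (key_jobs J w \<sigma>) \<subseteq> J" using K(1) bij by (auto simp: bij_betw_def key_jobs_def)
  show "distinct (key_jobs J w \<sigma>)"
    using K bij
    by (auto simp: key_jobs_def distinct_map bij_betw_def strict_sorted_iff intro: inj_on_subset)
  show "sorted_wrt (\<lambda>a b. p a \<le> p b) (key_jobs J w \<sigma>)"
    unfolding sorted_wrt_map key_jobs_def
    by (rule sorted_wrt_mono_rel[OF _ K(2)]) (use K(1) mon in blast)
qed

lemma key_schedule_half:
  assumes inst: "wsps_instance J p w" and \<sigma>: "job_indexing J p w \<sigma>" and S: "feasible J p S"
  shows "weighted_overlap J w S \<le> 2 * weighted_overlap J w (key_schedule J p w \<sigma>)"
proof -
  have fin: "finite J" and pos: "\<And>j. j \<in> J \<Longrightarrow> 0 < p j" and w0: "\<And>j. j \<in> J \<Longrightarrow> 0 \<le> w j"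
    using inst by (auto simp: wsps_instance_def)
  define n where "n = card J"
  define ks where "ks = key_sequence n (\<lambda>k. w (\<sigma> k))"
  define js where "js = key_jobs J w \<sigma>"
  define l where "l = length ks"
  have js_map: "js = map \<sigma> ks" by (simp add: js_def key_jobs_def ks_def n_def)
  have bij: "bij_betw \<sigma> {1..n} J"
    and mon: "\<And>a b. a \<in> {1..n} \<Longrightarrow> b \<in> {1..n} \<Longrightarrow> a < b \<Longrightarrow> p (\<sigma> a) \<le> p (\<sigma> b)"
    using \<sigma> unfolding job_indexing_def n_def by blast+
  have K: "is_key_sequence n (\<lambda>k. w (\<sigma> k)) ks"
    unfolding ks_def by (rule is_key_sequence_key_sequence)
  have sub: "set ks \<subseteq> {1..n}" and srt: "sorted_wrt (<) ks" and lst: "last (0 # ks) = n"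
    and dec: "sorted_wrt (\<lambda>a b. w (\<sigma> a) > w (\<sigma> b)) ks"
    and blk: "\<And>j k. j < length ks \<Longrightarrow> k \<in> {(0 # ks) ! j + 1 .. ks ! j} \<Longrightarrow> w (\<sigma> k) \<le> w (\<sigma> (ks ! j))"
    using K unfolding is_key_sequence_def by blast+
  have mem: "ks ! k \<in> {1..n}" if "k < l" for k using sub that nth_mem unfolding l_def by blast
  have \<sigma>J: "\<sigma> x \<in> J" if "x \<in> {1..n}" for x using bij that by (auto simp: bij_betw_def)
  \<comment> \<open>The value 0 past the end turns the last key weight into a drop
    \<open>u k - u (Suc k)\<close> too.\<close>
  define u where "u k = (if k < l then w (\<sigma> (ks ! k)) else 0)" for k
  define C where "C = sync_C p js"
  have jsJ: "set js \<subseteq> J" "distinct js" "sorted_wrt (\<lambda>a b. p a \<le> p b) js"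
    using key_jobs_props[OF \<sigma>] by (auto simp: js_def)
  have posj: "0 < p j" if "j \<in> set js" for j using that jsJ pos by blast
  have u_dec: "0 \<le> u k - u (Suc k)" if "k < l" for k
  proof (cases "Suc k < l")
    case True
    then have "w (\<sigma> (ks ! Suc k)) < w (\<sigma> (ks ! k))"
      using dec by (auto simp: sorted_wrt_iff_nth_less l_def)
    then show ?thesis using True by (simp add: u_def)
  next
    case False
    then show ?thesis using that w0[OF \<sigma>J[OF mem[OF that]]] by (simp add: u_def)
  qed
  have "weighted_overlap J w (key_schedule J p w \<sigma>) = (\<Sum>k<l. u k * (C (Suc k) - C k))"
    unfolding key_schedule_def js_def[symmetric] C_def
    by (subst weighted_overlap_sync_schedule[OF posj jsJ(3) jsJ(2) jsJ(1) fin])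
       (auto simp: js_map l_def u_def simp del: sync_C.simps intro!: sum.cong)
  also have "\<dots> = (\<Sum>k<l. (u k - u (Suc k)) * C (Suc k))"
    by (subst sum_by_parts) (simp add: u_def C_def)
  finally have key: "weighted_overlap J w (key_schedule J p w \<sigma>) =
    (\<Sum>k<l. (u k - u (Suc k)) * C (Suc k))" .
  \<comment> \<open>Condition (iii) bounds the weight by the key weight \<open>u m\<close> of the
    block of \<open>x\<close>, which telescopes into the drops from \<open>m\<close> on; all later
    key indices are at least \<open>x\<close>.\<close>
  have wle: "w (\<sigma> x) \<le> (\<Sum>k\<in>{k. k < l \<and> x \<le> ks ! k}. u k - u (Suc k))" if x: "x \<in> {1..n}" for x
  proof -
    obtain m where m: "m < length ks" "(0 # ks) ! m < x" "x \<le> ks ! m"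
      using key_block[OF lst x] by blast
    have "w (\<sigma> x) \<le> u m" using blk[of m x] m by (auto simp: u_def l_def)
    also have "u m = u m - u l" by (simp add: u_def)
    also have "\<dots> = (\<Sum>k=m..<l. u k - u (Suc k))"
      using m sum_Suc_diff'[of m l "\<lambda>k. - u k"] by (simp add: l_def)
    also have "\<dots> \<le> (\<Sum>k\<in>{k. k < l \<and> x \<le> ks ! k}. u k - u (Suc k))"
    proof (rule sum_mono2)
      show "{m..<l} \<subseteq> {k. k < l \<and> x \<le> ks ! k}"
      proof
        fix k assume k: "k \<in> {m..<l}"
        then have "ks ! m \<le> ks ! k"
          using sorted_wrt_nth_less[OF srt, of m k] by (cases "m = k") (auto simp: l_def)
        then show "k \<in> {k. k < l \<and> x \<le> ks ! k}" using k m by simp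
      qed
    qed (use u_dec in auto)
    finally show ?thesis .
  qed
  \<comment> \<open>Every job indexed up to \<open>ks ! k\<close> has its private end no later than
    the processing time of the \<open>k\<close>-th key job, as the indexing sorts by processing
    time.\<close>
  have tot: "(\<Sum>x\<in>{x. x \<in> {1..n} \<and> x \<le> ks ! k}. overlap S (\<sigma> x)) \<le> p (\<sigma> (ks ! k))"
    if k: "k < l" for k
  proof -
    let ?X = "{x. x \<in> {1..n} \<and> x \<le> ks ! k}"
    have inj: "inj_on \<sigma> ?X" by (rule inj_on_subset[OF bij_betw_imp_inj_on[OF bij]]) auto
    have "(\<Sum>x\<in>?X. overlap S (\<sigma> x)) = (\<Sum>j\<in>\<sigma> ` ?X. overlap S j)"
      using sum.reindex[OF inj, of "overlap S"] by simp
    also have "\<dots> \<le> p (\<sigma> (ks ! k))"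
    proof (rule sum_overlap_le[OF S])
      show "\<sigma> ` ?X \<subseteq> J" using \<sigma>J by auto
      show "private_end S j \<le> p (\<sigma> (ks ! k))" if j: "j \<in> \<sigma> ` ?X" for j
      proof -
        obtain x where x: "x \<in> {1..n}" "x \<le> ks ! k" "j = \<sigma> x" using j by auto
        have "p (\<sigma> x) \<le> p (\<sigma> (ks ! k))"
          using mon[OF x(1) mem[OF k]] x by (cases "x = ks ! k") auto
        then show ?thesis using feasible_private_end_le[OF S \<sigma>J[OF x(1)]] x by simp
      qed
      show "0 \<le> p (\<sigma> (ks ! k))" using pos[OF \<sigma>J[OF mem[OF k]]] by simp
    qed auto
    finally show ?thesis .
  qed
  have "weighted_overlap J w S = (\<Sum>x\<in>{1..n}. overlap S (\<sigma> x) * w (\<sigma> x))"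
    unfolding weighted_overlap_def by (rule sum.reindex_bij_betw[OF bij, symmetric])
  also have "\<dots> \<le> (\<Sum>x\<in>{1..n}. overlap S (\<sigma> x) * (\<Sum>k\<in>{k. k < l \<and> x \<le> ks ! k}. u k - u (Suc k)))"
    using wle by (intro sum_mono mult_left_mono overlap_nonneg) auto
  also have "\<dots> = (\<Sum>x\<in>{1..n}. \<Sum>k\<in>{k. k \<in> {..<l} \<and> x \<le> ks ! k}. overlap S (\<sigma> x) * (u k - u (Suc k)))"
    by (simp add: sum_distrib_left)
  \<comment> \<open>Regroups the sum by weight levels instead of by jobs, so that \<open>tot\<close>
    bounds each level.\<close>
  also have "\<dots> = (\<Sum>k<l. \<Sum>x\<in>{x. x \<in> {1..n} \<and> x \<le> ks ! k}. overlap S (\<sigma> x) * (u k - u (Suc k)))"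
    by (rule sum.swap_restrict) auto
  also have "\<dots> = (\<Sum>k<l. (u k - u (Suc k)) * (\<Sum>x\<in>{x. x \<in> {1..n} \<and> x \<le> ks ! k}. overlap S (\<sigma> x)))"
    by (simp add: sum_distrib_left mult.commute)
  also have "\<dots> \<le> (\<Sum>k<l. (u k - u (Suc k)) * (2 * C (Suc k)))"
  proof (intro sum_mono mult_left_mono)
    fix k assume "k \<in> {..<l}"
    then have k: "k < l" by simp
    show "0 \<le> u k - u (Suc k)" by (rule u_dec[OF k])
    have "0 \<le> C k"
      using sync_C_bounds[OF posj jsJ(3), of k] k by (simp add: C_def js_map l_def)
    \<comment> \<open>The source of the factor 2: twice \<open>C (Suc k)\<close> is this processing
      time plus \<open>C k\<close>.\<close>
    then have "p (\<sigma> (ks ! k)) \<le> 2 * C (Suc k)" using k by (simp add: C_def js_map l_def)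
    then show "(\<Sum>x\<in>{x. x \<in> {1..n} \<and> x \<le> ks ! k}. overlap S (\<sigma> x)) \<le> 2 * C (Suc k)"
      using tot[OF k] by linarith
  qed
  also have "\<dots> = 2 * weighted_overlap J w (key_schedule J p w \<sigma>)"
    by (simp add: key sum_distrib_left algebra_simps)
  finally show ?thesis .
qed

section \<open>Tightness\<close>

lemma key_schedule_tight:
  assumes "0 < (\<epsilon>::real)"
  shows "\<exists>(J :: nat set) p w \<sigma> S. wsps_instance J p w \<and> job_indexing J p w \<sigma> \<and> optimal J p w S \<and>
    weighted_overlap J w (key_schedule J p w \<sigma>) < (1/2 + \<epsilon>) * weighted_overlap J w S"
proof -
  \<comment> \<open>Chosen so that \<open>1 - (1/2) ^ N\<close> exceeds
    \<open>(1/2) / (1/2 + \<epsilon>)\<close>, the value that the optimum has to beat.\<close>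
  obtain N where N: "(1/2) ^ N < 2 * \<epsilon> / (1 + 2 * \<epsilon>)"
    using real_arch_pow_inv[of "2 * \<epsilon> / (1 + 2 * \<epsilon>)" "1/2"] assms by auto
  define n where "n = Suc N"
  define J where "J = {1..n}"
  define p w :: "nat \<Rightarrow> real" where "p = (\<lambda>_. 1)" and "w = (\<lambda>_. 1)"
  have inst: "wsps_instance J p w" by (simp add: wsps_instance_def J_def p_def w_def)
  have \<sigma>: "job_indexing J p w id" by (simp add: job_indexing_def J_def p_def w_def)
  obtain S where S: "optimal J p w S" using optimal_exists[OF inst] by blast
  \<comment> \<open>With equal weights, strict decrease leaves room for the last index only.\<close>
  have "is_key_sequence n (\<lambda>k. w (id k)) [n]" by (auto simp: is_key_sequence_def w_def n_def)
  then have "key_sequence n (\<lambda>k. w (id k)) = [n]"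
    using key_sequence_ex1 is_key_sequence_key_sequence by metis
  then have kj: "key_jobs J w id = [n]" by (simp add: key_jobs_def J_def)
  have key: "weighted_overlap J w (key_schedule J p w id) = 1/2"
    unfolding key_schedule_def kj
    by (subst weighted_overlap_sync_schedule) (auto simp: p_def w_def J_def n_def)
  define js where "js = [1..<Suc n]"
  have js: "set js = J" "distinct js" "length js = n" by (auto simp: js_def J_def)
  have srt: "sorted_wrt (\<lambda>a b. p a \<le> p b) js" by (simp add: p_def sorted_wrt_iff_nth_less)
  have C: "sync_C p js k = 1 - (1/2) ^ k" for k by (induction k) (auto simp: p_def field_simps)
  have "feasible J p (sync_schedule p js)"
    using js srt by (intro feasible_sync_schedule) (auto simp: p_def)
  then have "weighted_overlap J w (sync_schedule p js) \<le> weighted_overlap J w S"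
    using S by (simp add: optimal_def)
  moreover have "weighted_overlap J w (sync_schedule p js) = (\<Sum>k<n. sync_C p js (Suc k) - sync_C p js k)"
    using js srt by (subst weighted_overlap_sync_schedule) (auto simp: p_def w_def J_def)
  moreover have "\<dots> = 1 - (1/2) ^ n"
    by (subst sum_lessThan_telescope) (simp only: C, simp)
  ultimately have "1 - (1/2) ^ n \<le> weighted_overlap J w S" by linarith
  moreover have "(1/2::real) ^ n \<le> (1/2) ^ N" unfolding n_def by (rule power_decreasing) auto
  ultimately have "1 - 2 * \<epsilon> / (1 + 2 * \<epsilon>) < weighted_overlap J w S" using N by linarith
  moreover have "1 - 2 * \<epsilon> / (1 + 2 * \<epsilon>) = (1/2) / (1/2 + \<epsilon>)" using assms by (simp add: field_simps)
  ultimately have "1/2 < (1/2 + \<epsilon>) * weighted_overlap J w S"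
    using assms pos_divide_less_eq[of "1/2 + \<epsilon>" "1/2" "weighted_overlap J w S"]
    by (simp only: mult.commute)
  then have "weighted_overlap J w (key_schedule J p w id) < (1/2 + \<epsilon>) * weighted_overlap J w S"
    by (simp only: key)
  then show ?thesis using inst \<sigma> S by (intro exI[of _ J] exI[of _ p] exI[of _ w] exI[of _ id] exI[of _ S]) simp
qed

section \<open>Total correctness with time bounds\<close>

primrec loop_free :: "com \<Rightarrow> bool" where
  "loop_free Skip = True"
| "loop_free (NAssign x e) = True"
| "loop_free (NUpdate a i e) = True"
| "loop_free (RAssign x e) = True"
| "loop_free (RUpdate a i e) = True"
| "loop_free (Seq c d) = (loop_free c \<and> loop_free d)"
| "loop_free (Cond b c d) = (loop_free c \<and> loop_free d)"
| "loop_free (While b c) = False"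

text \<open>A functional semantics for loop-free commands, with which the simplifier can run loop
  bodies symbolically.\<close>

primrec post :: "com \<Rightarrow> state \<Rightarrow> state" where
  "post Skip s = s"
| "post (NAssign x e) s = s\<lparr>nvar := (nvar s)(x := nval s e)\<rparr>"
| "post (NUpdate a i e) s = s\<lparr>narr := (narr s)(a := (narr s a)(nval s i := nval s e))\<rparr>"
| "post (RAssign x e) s = s\<lparr>rvar := (rvar s)(x := rval s e)\<rparr>"
| "post (RUpdate a i e) s = s\<lparr>rarr := (rarr s)(a := (rarr s a)(nval s i := rval s e))\<rparr>"
| "post (Seq c d) s = post d (post c s)"
| "post (Cond b c d) s = (if bval s b then post c s else post d s)"
| "post (While b c) s = s"

text \<open>Conditionals take the costlier branch, so the bound is independent of the state and
  charges a constant per loop iteration.\<close>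

primrec time_bound :: "com \<Rightarrow> nat" where
  "time_bound Skip = 1"
| "time_bound (NAssign x e) = 1 + ncost e"
| "time_bound (NUpdate a i e) = 1 + ncost i + ncost e"
| "time_bound (RAssign x e) = 1 + rcost e"
| "time_bound (RUpdate a i e) = 1 + ncost i + rcost e"
| "time_bound (Seq c d) = 1 + time_bound c + time_bound d"
| "time_bound (Cond b c d) = 1 + bcost b + max (time_bound c) (time_bound d)"
| "time_bound (While b c) = 0"

lemma exec_loop_free:
  assumes "loop_free c"
  shows "\<exists>t. exec c s t (post c s) \<and> t \<le> time_bound c"
  using assms
proof (induction c arbitrary: s)
  case (Seq c d)
  obtain t where t: "exec c s t (post c s)" "t \<le> time_bound c" using Seq by auto
  obtain u where u: "exec d (post c s) u (post d (post c s))" "u \<le> time_bound d"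
    using Seq by auto
  show ?case using exec.Seq[OF t(1) u(1)] t u by (intro exI[of _ "1 + t + u"]) auto
next
  case (Cond b c d)
  obtain t where t: "exec c s t (post c s)" "t \<le> time_bound c" using Cond by auto
  obtain u where u: "exec d s u (post d s)" "u \<le> time_bound d" using Cond by auto
  show ?case
  proof (cases "bval s b")
    case True
    then show ?thesis using exec.CondTrue[OF True t(1), of d] t
      by (intro exI[of _ "1 + bcost b + t"]) auto
  next
    case False
    then show ?thesis using exec.CondFalse[OF False u(1), of c] u
      by (intro exI[of _ "1 + bcost b + u"]) auto
  qed
qed (use exec.intros in fastforce)+

definition while_time :: "bexp \<Rightarrow> com \<Rightarrow> nat \<Rightarrow> nat" where
  "while_time b c k = (1 + bcost b + time_bound c) * k + (1 + bcost b)"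

text \<open>The measure limits the number of iterations, each of bounded cost; the last summand of
  \<open>while_time\<close> pays for the final failing test.\<close>

lemma exec_while:
  assumes lf: "loop_free c"
    and step: "\<And>s. I s \<Longrightarrow> bval s b \<Longrightarrow> I (post c s) \<and> \<mu> (post c s) < \<mu> s"
    and I: "I s"
  shows "\<exists>t s'. exec (While b c) s t s' \<and> I s' \<and> \<not> bval s' b \<and> t \<le> while_time b c (\<mu> s)"
  using I
proof (induction "\<mu> s" arbitrary: s rule: less_induct)
  case less
  show ?case
  proof (cases "bval s b")
    case True
    obtain t where t: "exec c s t (post c s)" "t \<le> time_bound c" using exec_loop_free[OF lf] by blast
    have m: "\<mu> (post c s) < \<mu> s" "I (post c s)" using step[OF less.prems True] by auto
    obtain u s' where u: "exec (While b c) (post c s) u s'" "I s'" "\<not> bval s' b"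
      "u \<le> while_time b c (\<mu> (post c s))"
      using less.hyps[OF m] by blast
    have "(1 + bcost b + time_bound c) * Suc (\<mu> (post c s)) \<le> (1 + bcost b + time_bound c) * \<mu> s"
      using m by (intro mult_le_mono2) simp
    then have "1 + bcost b + t + u \<le> while_time b c (\<mu> s)"
      using t(2) u(4) by (simp add: while_time_def)
    then show ?thesis using exec.WhileTrue[OF True t(1) u(1)] u by blast
  next
    case False
    then show ?thesis using exec.WhileFalse[OF False] less.prems
      by (intro exI[of _ "1 + bcost b"] exI[of _ s]) (auto simp: while_time_def)
  qed
qed

section \<open>Bottom-up merge sort\<close>

text \<open>One merging pass turns the array \<open>x \<mapsto> f (s + x)\<close>, sorted in blocks of length \<open>d\<close>, into the array
  \<open>x \<mapsto> f (s + n + x)\<close>, sorted in blocks of length \<open>2 * d\<close>.  The next output position is \<open>q\<close>; the blocks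
  being merged start at \<open>lo\<close> and at \<open>m\<close>, end before \<open>e\<close>, and are consumed up to \<open>i\<close> and \<open>j\<close>.\<close>

definition block_sorted :: "('a \<Rightarrow> 'a \<Rightarrow> bool) \<Rightarrow> nat \<Rightarrow> (nat \<Rightarrow> 'a) \<Rightarrow> nat \<Rightarrow> bool" where
  "block_sorted le d A N \<longleftrightarrow> (\<forall>x y. x \<le> y \<and> y < N \<and> x div d = y div d \<longrightarrow> le (A x) (A y))"

text \<open>The image equation says that the output holds the consumed entries; the last clause says
  that the output of the current pair is below everything still pending in it.\<close>

definition merge_active ::
  "(nat \<Rightarrow> nat \<Rightarrow> bool) \<Rightarrow> nat \<Rightarrow> (nat \<Rightarrow> nat) \<Rightarrow> nat \<Rightarrow> nat \<Rightarrow> nat \<Rightarrow> nat \<Rightarrow> nat \<Rightarrow> nat \<Rightarrow> nat \<Rightarrow> nat \<Rightarrow> bool" where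
  "merge_active le n f s d i m j e q lo \<longleftrightarrow>
     2 * d dvd lo \<and> lo \<le> i \<and> i \<le> m \<and> m \<le> j \<and> j \<le> e \<and> q = i + (j - m) \<and>
     m = min n (lo + d) \<and> e = min n (lo + 2 * d) \<and>
     (\<lambda>x. f (s + n + x)) ` {..<q} = (\<lambda>x. f (s + x)) ` ({..<i} \<union> {m..<j}) \<and>
     (\<forall>x\<in>{lo..<q}. \<forall>y\<in>{i..<m} \<union> {j..<e}. le (f (s + n + x)) (f (s + y)))"

text \<open>Being a permutation is expressed by an image equation, which forces injectivity on the
  finite set \<open>{..<n}\<close>. The case \<open>q = e\<close> lies between two pairs of blocks.
  The program does not store \<open>lo\<close>, hence the existential quantifier.\<close>

definition merge_inv ::
  "(nat \<Rightarrow> nat \<Rightarrow> bool) \<Rightarrow> nat \<Rightarrow> (nat \<Rightarrow> nat) \<Rightarrow> nat \<Rightarrow> nat \<Rightarrow> nat \<Rightarrow> nat \<Rightarrow> nat \<Rightarrow> nat \<Rightarrow> nat \<Rightarrow> bool" where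
  "merge_inv le n f s d i m j e q \<longleftrightarrow>
     0 < d \<and> q \<le> e \<and> e \<le> n \<and> (\<lambda>x. f (s + x)) ` {..<n} = {..<n} \<and>
     block_sorted le d (\<lambda>x. f (s + x)) n \<and> block_sorted le (2 * d) (\<lambda>x. f (s + n + x)) q \<and>
     (q = e \<and> (e = n \<or> 2 * d dvd e) \<and> (\<lambda>x. f (s + n + x)) ` {..<q} = (\<lambda>x. f (s + x)) ` {..<q} \<or>
      q < e \<and> (\<exists>lo. merge_active le n f s d i m j e q lo))"

lemma merge_inv_start:
  assumes inv: "merge_inv le n f s d i m j e q" and q: "\<not> q < e" "q < n"
  shows "merge_inv le n f s d q (min n (q + d)) (min n (q + d)) (min n (min n (q + d) + d)) q"
    "q < min n (min n (q + d) + d)"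
proof -
  have d: "0 < d" and e: "q = e" "2 * d dvd q"
    and im: "(\<lambda>x. f (s + n + x)) ` {..<q} = (\<lambda>x. f (s + x)) ` {..<q}"
    using inv q by (auto simp: merge_inv_def)
  define M where "M = min n (q + d)"
  \<comment> \<open>Agrees with \<open>min n (q + 2 * d)\<close>, also when \<open>M\<close> was cut
    off at \<open>n\<close>.\<close>
  define E where "E = min n (M + d)"
  have "merge_active le n f s d q M M E q q"
    using e im q by (auto simp: merge_active_def M_def E_def)
  moreover have lt: "q < E" using d q by (auto simp: M_def E_def)
  moreover have "E \<le> n" "q \<le> E" using lt by (auto simp: E_def)
  ultimately have "merge_inv le n f s d q M M E q" using inv unfolding merge_inv_def by blast
  then show "merge_inv le n f s d q (min n (q + d)) (min n (q + d)) (min n (min n (q + d) + d)) q"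
    "q < min n (min n (q + d) + d)"
    using lt by (simp_all only: M_def E_def)
qed

text \<open>The finished output becomes the source of a pass with doubled block length. At
  \<open>q = e = 0\<close> nothing has been written, so the claims about the new output are
  vacuous.\<close>

lemma merge_inv_next:
  assumes inv: "merge_inv le n f s d i m j e q" and q: "\<not> q < n"
  shows "merge_inv le n f (s + n) (d + d) i m j 0 0"
proof -
  have "q = n" "e = n" using inv q by (auto simp: merge_inv_def)
  then show ?thesis using inv unfolding mult_2[of d, symmetric]
    by (auto simp: merge_inv_def block_sorted_def)
qed

lemma div_eq_of_bounds:
  fixes d :: nat
  assumes "d dvd a" "a \<le> x" "x < a + d"
  shows "x div d = a div d"
  using assms by (auto simp: dvd_def intro!: div_nat_eqI simp: algebra_simps)

lemma le_of_div_eq: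
  fixes d :: nat
  assumes "d dvd a" "x div d = a div d"
  shows "a \<le> x"
  by (metis assms dvd_div_mult_self div_times_less_eq_dividend)

text \<open>The common core of both merge moves: the entry at \<open>z\<close> is copied,
  \<open>i'\<close> and \<open>j'\<close> are the advanced positions, and the assumption on
  \<open>le\<close> says that the entry is minimal among those that remain.\<close>

lemma merge_inv_put:
  assumes inv: "merge_inv le n f s d i m j e q" and act: "merge_active le n f s d i m j e q lo"
    and qe: "q < e" and refl: "\<And>x. le x x"
    and z: "z \<in> {i..<m} \<union> {j..<e}" and le: "\<And>y. y \<in> {i'..<m} \<union> {j'..<e} \<Longrightarrow> le (f (s + z)) (f (s + y))"
    and ij: "i' = Suc i \<and> j' = j \<and> z = i \<or> i' = i \<and> j' = Suc j \<and> z = j"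
    and bnd: "i' \<le> m" "j' \<le> e"
  shows "merge_inv le n (f(s + n + q := f (s + z))) s d i' m j' e (Suc q)"
proof -
  let ?f = "f(s + n + q := f (s + z))"
  have d: "0 < d" "e \<le> n" and perm: "(\<lambda>x. f (s + x)) ` {..<n} = {..<n}"
    and A: "block_sorted le d (\<lambda>x. f (s + x)) n"
    and B: "block_sorted le (2 * d) (\<lambda>x. f (s + n + x)) q"
    using inv by (auto simp: merge_inv_def)
  have lo: "2 * d dvd lo" "lo \<le> i" "i \<le> m" "m \<le> j" "j \<le> e" "q = i + (j - m)"
     "m = min n (lo + d)" "e = min n (lo + 2 * d)"
     and im: "(\<lambda>x. f (s + n + x)) ` {..<q} = (\<lambda>x. f (s + x)) ` ({..<i} \<union> {m..<j})"
     and cross: "\<And>x y. x \<in> {lo..<q} \<Longrightarrow> y \<in> {i..<m} \<union> {j..<e} \<Longrightarrow> le (f (s + n + x)) (f (s + y))"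
    using act unfolding merge_active_def by blast+
  \<comment> \<open>The write goes to \<open>s + n + q\<close>, beyond the source segment.\<close>
  have srcf: "?f (s + x) = f (s + x)" if "x < n" for x using that by simp
  have src: "(\<lambda>x. ?f (s + x)) ` X = (\<lambda>x. f (s + x)) ` X" if "X \<subseteq> {..<n}" for X
    using that srcf by (intro image_cong) auto
  have im': "(\<lambda>x. ?f (s + n + x)) ` {..<Suc q} = (\<lambda>x. f (s + x)) ` ({..<i'} \<union> {m..<j'})"
  proof -
    have "(\<lambda>x. ?f (s + n + x)) ` {..<Suc q} = insert (f (s + z)) ((\<lambda>x. f (s + n + x)) ` {..<q})"
      unfolding lessThan_Suc image_insert by (auto intro!: arg_cong2[where f = insert] image_cong)
    also have "\<dots> = (\<lambda>x. f (s + x)) ` (insert z ({..<i} \<union> {m..<j}))" using im by simp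
    also have "insert z ({..<i} \<union> {m..<j}) = {..<i'} \<union> {m..<j'}" using ij lo by auto
    finally show ?thesis .
  qed
  have B': "block_sorted le (2 * d) (\<lambda>x. ?f (s + n + x)) (Suc q)"
    unfolding block_sorted_def
  proof (intro allI impI)
    fix x y assume xy: "x \<le> y \<and> y < Suc q \<and> x div (2 * d) = y div (2 * d)"
    show "le (?f (s + n + x)) (?f (s + n + y))"
    proof (cases "y = q")
      case False
      then show ?thesis using B xy by (auto simp: block_sorted_def)
    next
      case True
      have "q div (2 * d) = lo div (2 * d)"
        using lo qe by (intro div_eq_of_bounds) auto
      \<comment> \<open>Output positions in the same double block as \<open>q\<close> belong to the
        current pair, so \<open>cross\<close> compares them with the new entry.\<close>
      then have "lo \<le> x" using le_of_div_eq[OF lo(1)] xy True by simp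
      then show ?thesis using cross[OF _ z, of x] refl xy True by (cases "x = q") auto
    qed
  qed
  have cross': "le (?f (s + n + x)) (?f (s + y))"
    if "x \<in> {lo..<Suc q}" "y \<in> {i'..<m} \<union> {j'..<e}" for x y
  proof -
    have y: "y \<in> {i..<m} \<union> {j..<e}" "y < n" using that ij d lo by auto
    show ?thesis using that le[of y] cross[OF _ y(1), of x] y(2) by (cases "x = q") auto
  qed
  have Suc_q: "Suc q = i' + (j' - m)" using ij lo by auto
  have act': "merge_active le n ?f s d i' m j' e (Suc q) lo"
    unfolding merge_active_def
  proof (intro conjI ballI)
    show "(\<lambda>x. ?f (s + n + x)) ` {..<Suc q} = (\<lambda>x. ?f (s + x)) ` ({..<i'} \<union> {m..<j'})"
      using src[of "{..<i'} \<union> {m..<j'}"] im' bnd lo d by auto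
    show "lo \<le> i'" "m \<le> j'" using ij lo(2,4) by auto
    show "le (?f (s + n + x)) (?f (s + y))" if "x \<in> {lo..<Suc q}" "y \<in> {i'..<m} \<union> {j'..<e}" for x y
      using that by (rule cross')
  qed (fact lo bnd Suc_q)+
  have fin: "(e = n \<or> 2 * d dvd e) \<and> (\<lambda>x. ?f (s + n + x)) ` {..<Suc q} = (\<lambda>x. ?f (s + x)) ` {..<Suc q}"
    if "Suc q = e"
  proof
    show "e = n \<or> 2 * d dvd e" using lo(8) dvd_add[OF lo(1) dvd_refl]
      by (simp add: min_def split: if_splits)
    have "m \<le> j'" using ij lo(4) by auto
    \<comment> \<open>Reaching the end of the pair means that both of its blocks are used
      up.\<close>
    then have "i' = m" "j' = e" using that Suc_q bnd by arith+
    then have "{..<i'} \<union> {m..<j'} = {..<Suc q}" using that lo(4,5) by auto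
    then show "(\<lambda>x. ?f (s + n + x)) ` {..<Suc q} = (\<lambda>x. ?f (s + x)) ` {..<Suc q}"
      using im' src[of "{..<Suc q}"] that d by auto
  qed
  have A': "block_sorted le d (\<lambda>x. ?f (s + x)) n" using A srcf by (auto simp: block_sorted_def)
  have "(\<lambda>x. ?f (s + x)) ` {..<n} = {..<n}" using perm src[of "{..<n}"] by auto
  moreover have "Suc q \<le> e" "Suc q = e \<or> Suc q < e" using qe by auto
  ultimately show ?thesis using A' B' act' fin d unfolding merge_inv_def by blast
qed

text \<open>Both halves of the pair lie within aligned blocks of length \<open>d\<close>, where the
  source is sorted.\<close>

lemma merge_active_sorted:
  assumes inv: "merge_inv le n f s d i m j e q" and act: "merge_active le n f s d i m j e q lo"
  shows "\<And>x y. i \<le> x \<Longrightarrow> x \<le> y \<Longrightarrow> y < m \<Longrightarrow> le (f (s + x)) (f (s + y))"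
    "\<And>x y. j \<le> x \<Longrightarrow> x \<le> y \<Longrightarrow> y < e \<Longrightarrow> le (f (s + x)) (f (s + y))"
proof -
  have A: "block_sorted le d (\<lambda>x. f (s + x)) n" using inv by (auto simp: merge_inv_def)
  have lo: "2 * d dvd lo" "lo \<le> i" "i \<le> m" "m \<le> j" "j \<le> e"
     "m = min n (lo + d)" "e = min n (lo + 2 * d)"
    using act unfolding merge_active_def by blast+
  have dv: "d dvd lo" "d dvd lo + d" using lo(1) by (auto dest: dvd_mult_right)
  fix x y
  show "le (f (s + x)) (f (s + y))" if "i \<le> x" "x \<le> y" "y < m"
    using div_eq_of_bounds[OF dv(1), of x] div_eq_of_bounds[OF dv(1), of y] that lo A
    by (auto simp: block_sorted_def)
  show "le (f (s + x)) (f (s + y))" if "j \<le> x" "x \<le> y" "y < e"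
  proof -
    \<comment> \<open>A nonempty right half shows that \<open>m\<close> was not cut off at
      \<open>n\<close>, so it is aligned.\<close>
    have "m = lo + d" using that lo by auto
    then show ?thesis
      using div_eq_of_bounds[OF dv(2), of x] div_eq_of_bounds[OF dv(2), of y] that lo A
      by (auto simp: block_sorted_def)
  qed
qed

lemma merge_inv_left:
  assumes inv: "merge_inv le n f s d i m j e q" and qe: "q < e"
    and refl: "\<And>x. le x x" and trans: "\<And>x y z. le x y \<Longrightarrow> le y z \<Longrightarrow> le x z"
    and i: "i < m" "j < e \<Longrightarrow> le (f (s + i)) (f (s + j))"
  shows "merge_inv le n (f(s + n + q := f (s + i))) s d (Suc i) m j e (Suc q)"
proof -
  obtain lo where act: "merge_active le n f s d i m j e q lo" using inv qe by (auto simp: merge_inv_def)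
  note srt = merge_active_sorted[OF inv act]
  have "le (f (s + i)) (f (s + y))" if "y \<in> {Suc i..<m} \<union> {j..<e}" for y
  proof (cases "y \<in> {j..<e}")
    case True
    then show ?thesis using i(2) srt(2)[of j y] trans by auto
  next
    case False
    then show ?thesis using that srt(1)[of i y] by auto
  qed
  then show ?thesis
    using i act by (intro merge_inv_put[OF inv act qe refl]) (auto simp: merge_active_def)
qed

lemma merge_inv_right:
  assumes inv: "merge_inv le n f s d i m j e q" and qe: "q < e"
    and refl: "\<And>x. le x x" and trans: "\<And>x y z. le x y \<Longrightarrow> le y z \<Longrightarrow> le x z"
    and i: "i < m \<Longrightarrow> j < e \<and> le (f (s + j)) (f (s + i))"
  shows "merge_inv le n (f(s + n + q := f (s + j))) s d i m (Suc j) e (Suc q)"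
proof -
  obtain lo where act: "merge_active le n f s d i m j e q lo" using inv qe by (auto simp: merge_inv_def)
  note srt = merge_active_sorted[OF inv act]
  \<comment> \<open>If the left half is exhausted, then \<open>q = j\<close>, and
    \<open>q < e\<close> leaves an entry on the right.\<close>
  have j: "j < e" using i act qe by (cases "i < m") (auto simp: merge_active_def)
  have "le (f (s + j)) (f (s + y))" if "y \<in> {i..<m} \<union> {Suc j..<e}" for y
  proof (cases "y \<in> {i..<m}")
    case True
    then show ?thesis using i srt(1)[of i y] trans by auto
  next
    case False
    then show ?thesis using that srt(2)[of j y] by auto
  qed
  then show ?thesis
    using j act by (intro merge_inv_put[OF inv act qe refl]) (auto simp: merge_active_def)
qed

section \<open>Scanning the sorted jobs with a stack\<close>

text \<open>By \<open>is_key_sequence_set\<close>, the key sequence of the first \<open>c\<close>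
  jobs as a set.\<close>

definition suffix_maxima :: "(nat \<Rightarrow> real) \<Rightarrow> nat \<Rightarrow> nat set" where
  "suffix_maxima v c = {i\<in>{1..c}. \<forall>k\<in>{i<..c}. v k < v i}"

text \<open>This recursion is what the stack implements: a new job always enters and evicts all jobs
  of at most its weight.\<close>

lemma suffix_maxima_Suc:
  "suffix_maxima v (Suc c) = insert (Suc c) {i \<in> suffix_maxima v c. v (Suc c) < v i}"
  by (auto simp: suffix_maxima_def le_Suc_eq)

text \<open>The stack may temporarily lack suffix maxima of the first \<open>c\<close> jobs that are dominated by the
  job \<open>Suc c\<close> about to be pushed.\<close>

definition stack_inv ::
  "(nat \<Rightarrow> real) \<Rightarrow> nat \<Rightarrow> (nat \<Rightarrow> nat) \<Rightarrow> (nat \<Rightarrow> nat) \<Rightarrow> nat \<Rightarrow> nat \<Rightarrow> bool" where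
  "stack_inv w n \<sigma> key len c \<longleftrightarrow> c \<le> n \<and> (\<exists>is. map \<sigma> is = map key [0..<len] \<and> sorted_wrt (<) is \<and>
     set is \<subseteq> suffix_maxima (\<lambda>k. w (\<sigma> k)) c \<and>
     (\<forall>x\<in>suffix_maxima (\<lambda>k. w (\<sigma> k)) c - set is. c < n \<and> w (\<sigma> x) \<le> w (\<sigma> (Suc c))))"

lemma stack_inv_init: "stack_inv w n \<sigma> key 0 0"
  by (simp add: stack_inv_def suffix_maxima_def)

text \<open>The popped job is dominated by the job \<open>Suc c\<close>, so the invariant allows it
  to be missing.\<close>

lemma stack_inv_pop:
  assumes inv: "stack_inv w n \<sigma> key len c" and c: "c < n" and len: "0 < len"
    and le: "\<not> w (\<sigma> (Suc c)) < w (key (len - 1))"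
  shows "stack_inv w n \<sigma> key (len - 1) c"
proof -
  obtain xs where xs: "map \<sigma> xs = map key [0..<len]" "sorted_wrt (<) xs"
     "set xs \<subseteq> suffix_maxima (\<lambda>k. w (\<sigma> k)) c"
     "\<forall>x\<in>suffix_maxima (\<lambda>k. w (\<sigma> k)) c - set xs. w (\<sigma> x) \<le> w (\<sigma> (Suc c))"
    using inv unfolding stack_inv_def by blast
  obtain l where l: "len = Suc l" using len by (cases len) auto
  obtain ys x where ys: "xs = ys @ [x]" using xs(1) l by (cases xs rule: rev_cases) auto
  have "map \<sigma> ys = map key [0..<l]" "\<sigma> x = key l" using xs(1) ys l by auto
  then show ?thesis
    using xs le c l inv unfolding ys stack_inv_def
    by (auto intro!: exI[of _ ys] simp: sorted_wrt_append)
qed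

lemma stack_inv_push:
  assumes inv: "stack_inv w n \<sigma> key len c" and c: "c < n"
    and lt: "0 < len \<Longrightarrow> w (\<sigma> (Suc c)) < w (key (len - 1))"
  shows "stack_inv w n \<sigma> (key(len := \<sigma> (Suc c))) (Suc len) (Suc c)"
proof -
  let ?v = "\<lambda>k. w (\<sigma> k)"
  obtain xs where xs: "map \<sigma> xs = map key [0..<len]" "sorted_wrt (<) xs"
     "set xs \<subseteq> suffix_maxima ?v c"
     "\<forall>x\<in>suffix_maxima ?v c - set xs. ?v x \<le> ?v (Suc c)"
    using inv unfolding stack_inv_def by blast
  \<comment> \<open>Weights strictly decrease towards the top of the stack, so comparing with the
    top entry suffices.\<close>
  have gt: "?v (Suc c) < ?v x" if x: "x \<in> set xs" for x
  proof (cases xs rule: rev_cases)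
    case Nil then show ?thesis using x by simp
  next
    case (snoc ys y)
    have "length xs = len" using xs(1) by (metis length_map length_upt minus_nat.diff_0)
    then have len: "len = Suc (length ys)" using snoc by simp
    have "\<sigma> y = key (len - 1)" using xs(1) snoc len by simp
    then have y: "?v (Suc c) < ?v y" using lt len by simp
    show ?thesis
    proof (cases "x = y")
      case False
      then have "x < y" using x snoc xs(2) by (auto simp: sorted_wrt_append)
      then have "?v y < ?v x" using xs(3) snoc x by (auto simp: suffix_maxima_def)
      then show ?thesis using y by simp
    qed (use y in simp)
  qed
  have set: "set (xs @ [Suc c]) = suffix_maxima ?v (Suc c)"
    using xs(3,4) gt by (force simp: suffix_maxima_Suc)
  have "x < Suc c" if "x \<in> set xs" for x using xs(3) that by (auto simp: suffix_maxima_def)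
  then have "sorted_wrt (<) (xs @ [Suc c])" using xs(2) by (simp add: sorted_wrt_append)
  moreover have "map \<sigma> (xs @ [Suc c]) = map (key(len := \<sigma> (Suc c))) [0..<Suc len]"
    using xs(1) by simp
  ultimately show ?thesis using set c unfolding stack_inv_def
    by (intro conjI exI[of _ "xs @ [Suc c]"]) auto
qed

text \<open>At \<open>c = n\<close> no suffix maximum may be missing, and a strictly sorted list is
  determined by its set.\<close>

lemma stack_inv_final:
  assumes inv: "stack_inv w n \<sigma> key len n"
  shows "map key [0..<len] = map \<sigma> (key_sequence n (\<lambda>k. w (\<sigma> k)))"
proof -
  let ?v = "\<lambda>k. w (\<sigma> k)"
  obtain xs where xs: "map \<sigma> xs = map key [0..<len]" "sorted_wrt (<) xs"
     "set xs = suffix_maxima ?v n"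
    using inv unfolding stack_inv_def by blast
  have K: "is_key_sequence n ?v (key_sequence n ?v)" by (rule is_key_sequence_key_sequence)
  have "xs = key_sequence n ?v"
  proof (rule strict_sorted_equal)
    show "sorted_wrt (<) (key_sequence n ?v)" using K by (simp add: is_key_sequence_def)
    show "set xs = set (key_sequence n ?v)"
      using is_key_sequence_set[OF K] xs(3) by (simp add: suffix_maxima_def)
  qed (rule xs(2))
  then show ?thesis using xs by simp
qed

section \<open>The program\<close>

abbreviation incr :: "string \<Rightarrow> com" where
  "incr x \<equiv> NAssign x (NAdd (NVar x) (NConst 1))"

text \<open>Minimum by truncated subtraction, see \<open>min_eq_diff_diff\<close>.\<close>

abbreviation nmin :: "nexp \<Rightarrow> nexp \<Rightarrow> nexp" where
  "nmin a b \<equiv> NSub a (NSub a b)"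

definition init_cond :: bexp where "init_cond = NLess (NVar ''x'') (NVar ''n'')"

definition init_body :: com where
  "init_body = Seq (NUpdate ''ord'' (NVar ''x'') (NVar ''x'')) (incr ''x'')"

definition sort_cond :: bexp where "sort_cond = NLess (NVar ''d'') (NVar ''n'')"

abbreviation src :: "string \<Rightarrow> nexp" where
  "src x \<equiv> NArr ''ord'' (NAdd (NVar ''s'') (NVar x))"

text \<open>The strict lexicographic order by \<open>p\<close>, then \<open>w\<close>, written
  without disjunction; on ties the left entry goes first.\<close>

definition right_less :: bexp where
  "right_less = BAnd (BNot (RLess (RArr ''p'' (src ''i'')) (RArr ''p'' (src ''j''))))
     (BNot (BAnd (BNot (RLess (RArr ''p'' (src ''j'')) (RArr ''p'' (src ''i''))))
                 (BNot (RLess (RArr ''w'' (src ''j'')) (RArr ''w'' (src ''i''))))))"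

definition take_left :: bexp where
  "take_left = BAnd (NLess (NVar ''i'') (NVar ''m''))
     (BNot (BAnd (NLess (NVar ''j'') (NVar ''e'')) right_less))"

definition put :: "string \<Rightarrow> com" where
  "put x = Seq (NUpdate ''ord'' (NAdd (NAdd (NVar ''s'') (NVar ''n'')) (NVar ''q'')) (src x))
     (Seq (incr x) (incr ''q''))"

definition start_block :: com where
  "start_block = Seq (NAssign ''i'' (NVar ''q''))
    (Seq (NAssign ''m'' (nmin (NAdd (NVar ''q'') (NVar ''d'')) (NVar ''n'')))
    (Seq (NAssign ''j'' (NVar ''m''))
         (NAssign ''e'' (nmin (NAdd (NVar ''m'') (NVar ''d'')) (NVar ''n'')))))"

text \<open>The output is not copied back: each pass moves on by \<open>n\<close> cells. The pass
  counter \<open>k\<close> serves the invariant \<open>d = 2 ^ k\<close> and the termination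
  measure.\<close>

definition next_pass :: com where
  "next_pass = Seq (NAssign ''s'' (NAdd (NVar ''s'') (NVar ''n'')))
    (Seq (NAssign ''d'' (NAdd (NVar ''d'') (NVar ''d'')))
    (Seq (incr ''k'') (Seq (NAssign ''q'' (NConst 0)) (NAssign ''e'' (NConst 0)))))"

text \<open>The nested loops of merge sort are flattened into one: an iteration writes one entry,
  opens a pair of blocks or starts a pass. This keeps the body loop-free, as
  \<open>exec_while\<close> requires.\<close>

definition sort_body :: com where
  "sort_body = Cond (NLess (NVar ''q'') (NVar ''n''))
     (Cond (NLess (NVar ''q'') (NVar ''e'')) (Cond take_left (put ''i'') (put ''j'')) start_block)
     next_pass"

definition scan_cond :: bexp where "scan_cond = NLess (NVar ''c'') (NVar ''n'')"

definition scan_body :: com where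
  "scan_body = Cond (BAnd (NLess (NConst 0) (NVar ''len''))
       (BNot (RLess (RArr ''w'' (src ''c''))
          (RArr ''w'' (NArr ''key'' (NSub (NVar ''len'') (NConst 1)))))))
     (NAssign ''len'' (NSub (NVar ''len'') (NConst 1)))
     (Seq (NUpdate ''key'' (NVar ''len'') (src ''c'')) (Seq (incr ''len'') (incr ''c'')))"

definition key_program :: com where
  "key_program = Seq (While init_cond init_body) (Seq (NAssign ''d'' (NConst 1))
     (Seq (While sort_cond sort_body) (While scan_cond scan_body)))"

section \<open>Invariant and termination measure of the sorting loop\<close>

definition job_le :: "('j \<Rightarrow> real) \<Rightarrow> ('j \<Rightarrow> real) \<Rightarrow> 'j \<Rightarrow> 'j \<Rightarrow> bool" where
  "job_le p w a b \<longleftrightarrow> p a < p b \<or> p a = p b \<and> w a \<le> w b"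

definition sort_inv :: "nat \<Rightarrow> (nat \<Rightarrow> real) \<Rightarrow> (nat \<Rightarrow> real) \<Rightarrow> state \<Rightarrow> bool" where
  "sort_inv n p w st \<longleftrightarrow> nvar st ''n'' = n \<and> rarr st ''p'' = p \<and> rarr st ''w'' = w \<and>
     nvar st ''c'' = 0 \<and> nvar st ''len'' = 0 \<and> nvar st ''d'' = 2 ^ nvar st ''k'' \<and>
     merge_inv (job_le p w) n (narr st ''ord'') (nvar st ''s'') (nvar st ''d'') (nvar st ''i'')
       (nvar st ''m'') (nvar st ''j'') (nvar st ''e'') (nvar st ''q'')"

text \<open>\<open>L\<close> bounds the number of passes. Writing an entry gains 2, of which 1 may
  go to the flag for opening the next pair; a new pass pays \<open>2 * n + 2\<close> and restores at
  most \<open>2 * n\<close>.\<close>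

definition sort_measure :: "nat \<Rightarrow> nat \<Rightarrow> state \<Rightarrow> nat" where
  "sort_measure L n st = (L - nvar st ''k'') * (2 * n + 2) + 2 * (n - nvar st ''q'') +
     (if nvar st ''q'' < nvar st ''e'' then 0 else 1)"

lemma min_eq_diff_diff: "(a::nat) - (a - b) = min b a"
  by auto

lemma sort_step:
  assumes inv: "sort_inv n p w st" and b: "bval st sort_cond" and L: "n \<le> 2 ^ L"
  shows "sort_inv n p w (post sort_body st) \<and> sort_measure L n (post sort_body st) < sort_measure L n st"
proof -
  let ?v = "nvar st" and ?f = "narr st ''ord''"
  have n: "?v ''n'' = n" and rp: "rarr st ''p'' = p" and rw: "rarr st ''w'' = w"
    and dk: "?v ''d'' = 2 ^ ?v ''k''" and z: "?v ''c'' = 0" "?v ''len'' = 0"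
    and M: "merge_inv (job_le p w) n ?f (?v ''s'') (?v ''d'') (?v ''i'') (?v ''m'') (?v ''j'')
       (?v ''e'') (?v ''q'')"
    using inv by (auto simp: sort_inv_def)
  have refl: "job_le p w x x" for x by (simp add: job_le_def)
  have trans: "job_le p w x y \<Longrightarrow> job_le p w y u \<Longrightarrow> job_le p w x u" for x y u
    by (auto simp: job_le_def)
  have qe: "?v ''q'' \<le> ?v ''e''" "?v ''e'' \<le> n" using M by (auto simp: merge_inv_def)
  consider (left) "?v ''q'' < ?v ''e''" "bval st take_left"
    | (right) "?v ''q'' < ?v ''e''" "\<not> bval st take_left"
    | (start) "\<not> ?v ''q'' < ?v ''e''" "?v ''q'' < n"
    | (next_pass) "\<not> ?v ''q'' < n"
    by blast
  then show ?thesis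
  proof cases
    case left
    have "?v ''i'' < ?v ''m''"
      "?v ''j'' < ?v ''e'' \<Longrightarrow> job_le p w (?f (?v ''s'' + ?v ''i'')) (?f (?v ''s'' + ?v ''j''))"
      using left(2) by (auto simp: take_left_def right_less_def job_le_def rp rw)
    from merge_inv_left[OF M left(1) refl trans this] 
    show ?thesis using left qe n rp rw dk z
      by (auto simp: sort_body_def put_def sort_inv_def sort_measure_def)
  next
    case right
    have "?v ''i'' < ?v ''m'' \<Longrightarrow>
      ?v ''j'' < ?v ''e'' \<and> job_le p w (?f (?v ''s'' + ?v ''j'')) (?f (?v ''s'' + ?v ''i''))"
      using right(2) by (auto simp: take_left_def right_less_def job_le_def rp rw)
    from merge_inv_right[OF M right(1) refl trans this] 
    show ?thesis using right qe n rp rw dk z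
      by (auto simp: sort_body_def put_def sort_inv_def sort_measure_def)
  next
    case start
    show ?thesis using merge_inv_start[OF M start] start qe n rp rw dk z
      by (simp add: sort_body_def start_block_def sort_inv_def sort_measure_def min_eq_diff_diff)
  next
    case next_pass
    have "?v ''d'' < n" using b n by (simp add: sort_cond_def)
    \<comment> \<open>A pass ends with the loop test still true, so \<open>k < L\<close> and the
      truncated difference \<open>L - k\<close> really drops.\<close>
    then have "(2::nat) ^ ?v ''k'' < 2 ^ L" using L unfolding dk by (rule order_less_le_trans)
    then have kL: "?v ''k'' < L" by simp
    then obtain r where r: "L - ?v ''k'' = Suc r" "L - Suc (?v ''k'') = r" by (metis Suc_diff_Suc)
    show ?thesis using merge_inv_next[OF M next_pass] next_pass qe n rp rw dk z r
      by (simp add: sort_body_def next_pass_def sort_inv_def sort_measure_def mult_2[symmetric])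
  qed
qed

section \<open>Correctness and running time of the whole program\<close>

definition key_time :: "nat \<Rightarrow> nat" where
  "key_time n = 5 + while_time init_cond init_body n +
     while_time sort_cond sort_body (nat \<lceil>log 2 (real n)\<rceil> * (2 * n + 2) + 2 * n + 1) +
     while_time scan_cond scan_body (2 * n)"

lemma exec_key_program:
  assumes "wsps_instance {..<n} p w"
  shows "\<exists>t s \<sigma>. exec key_program (input_state n p w) t s \<and> t \<le> key_time n \<and>
    job_indexing {..<n} p w \<sigma> \<and> output_list s = key_jobs {..<n} w \<sigma>"
proof -
  \<comment> \<open>The arrays that the machine actually holds: the input padded with zeros.\<close>
  define p' w' where "p' i = (if i < n then p i else 0)" and "w' i = (if i < n then w i else 0)" for i
  define s0 where "s0 = input_state n p w"
  define I where "I st \<longleftrightarrow> nvar st ''n'' = n \<and> rarr st ''p'' = p' \<and> rarr st ''w'' = w' \<and>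
     (\<forall>y. y \<noteq> ''n'' \<and> y \<noteq> ''x'' \<longrightarrow> nvar st y = 0) \<and> nvar st ''x'' \<le> n \<and>
     (\<forall>y<nvar st ''x''. narr st ''ord'' y = y)" for st :: state
  have "I s0" by (auto simp: I_def s0_def input_state_def p'_def w'_def)
  moreover have "I (post init_body st) \<and> n - nvar (post init_body st) ''x'' < n - nvar st ''x''"
    if "I st" "bval st init_cond" for st
    using that by (auto simp: I_def init_cond_def init_body_def)
  ultimately obtain t1 s1 where 1: "exec (While init_cond init_body) s0 t1 s1" "I s1"
      "\<not> bval s1 init_cond" "t1 \<le> while_time init_cond init_body (n - nvar s0 ''x'')"
    using exec_while[of init_body I init_cond "\<lambda>st. n - nvar st ''x''" s0]
    by (auto simp: init_body_def)
  define s2 where "s2 = s1\<lparr>nvar := (nvar s1)(''d'' := nval s1 (NConst 1))\<rparr>"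
  have 2: "exec (NAssign ''d'' (NConst 1)) s1 2 s2"
    using exec.NAssign[of "''d''" "NConst 1" s1] by (simp add: s2_def numeral_2_eq_2)
  have ord: "narr s1 ''ord'' y = y" if "y < n" for y
    using 1 that by (auto simp: I_def init_cond_def)
  have "sort_inv n p' w' s2"
    \<comment> \<open>Blocks of length 1 are sorted by reflexivity.\<close>
    using 1(2) ord by (auto simp: I_def s2_def sort_inv_def merge_inv_def block_sorted_def job_le_def)
  moreover define L where "L = nat \<lceil>log 2 (real n)\<rceil>"
  have L: "n \<le> 2 ^ L"
  proof (cases "n = 0")
    case False
    have "real n = 2 powr log 2 (real n)" using False by simp
    also have "\<dots> \<le> 2 powr real L" unfolding L_def by (intro powr_mono) (auto simp: real_nat_ceiling_ge)
    also have "\<dots> = real (2 ^ L)" by (simp add: powr_realpow)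
    finally show ?thesis by (simp only: of_nat_le_iff)
  qed simp
  ultimately obtain t3 s3 where 3: "exec (While sort_cond sort_body) s2 t3 s3" "sort_inv n p' w' s3"
      "\<not> bval s3 sort_cond" "t3 \<le> while_time sort_cond sort_body (sort_measure L n s2)"
    using exec_while[of sort_body "sort_inv n p' w'" sort_cond "sort_measure L n" s2]
      sort_step[OF _ _ L]
    by (auto simp: sort_body_def put_def start_block_def next_pass_def)
  have m2: "sort_measure L n s2 = L * (2 * n + 2) + 2 * n + 1"
    using 1(2) by (simp add: sort_measure_def s2_def I_def)
  \<comment> \<open>The shift by 1 links the array, which starts at 0, to indexings of
    \<open>{1..n}\<close>.\<close>
  define \<sigma> where "\<sigma> k = narr s3 ''ord'' (nvar s3 ''s'' + (k - 1))" for k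
  have n3: "nvar s3 ''n'' = n" "rarr s3 ''w'' = w'" "nvar s3 ''c'' = 0" "nvar s3 ''len'' = 0"
    and M: "(\<lambda>x. narr s3 ''ord'' (nvar s3 ''s'' + x)) ` {..<n} = {..<n}"
      "block_sorted (job_le p' w') (nvar s3 ''d'') (\<lambda>x. narr s3 ''ord'' (nvar s3 ''s'' + x)) n"
    using 3(2) by (auto simp: sort_inv_def merge_inv_def)
  \<comment> \<open>At loop exit one block covers the whole array, so all of it is sorted.\<close>
  have dn: "n \<le> nvar s3 ''d''" using 3(3) n3 by (simp add: sort_cond_def)
  have "{..<n} = (\<lambda>k. k - 1) ` {1..n}" by (force simp: image_iff Bex_def intro: exI[of _ "Suc _"])
  then have im: "\<sigma> ` {1..n} = {..<n}" using M(1) by (simp add: \<sigma>_def image_image)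
  have bij: "bij_betw \<sigma> {1..n} {..<n}"
    using im by (simp add: bij_betw_def eq_card_imp_inj_on)
  have \<sigma>n: "\<sigma> a < n" if "a \<in> {1..n}" for a using im that by blast
  have srt: "job_le p w (\<sigma> a) (\<sigma> b)" if "a \<in> {1..n}" "b \<in> {1..n}" "a < b" for a b
  proof -
    have "a - 1 \<le> b - 1" "b - 1 < n" "a - 1 < nvar s3 ''d''" "b - 1 < nvar s3 ''d''"
      using that dn by auto
    then have "job_le p' w' (\<sigma> a) (\<sigma> b)" using M(2) by (simp add: block_sorted_def \<sigma>_def)
    then show ?thesis using \<sigma>n that by (simp add: job_le_def p'_def w'_def)
  qed
  have idx: "job_indexing {..<n} p w \<sigma>"
    unfolding job_indexing_def card_lessThan
  proof (intro conjI ballI impI)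
    fix a b assume "a \<in> {1..n}" "b \<in> {1..n}" "a < b"
    from srt[OF this] show "p (\<sigma> a) \<le> p (\<sigma> b)" "p (\<sigma> a) = p (\<sigma> b) \<Longrightarrow> w (\<sigma> a) \<le> w (\<sigma> b)"
      by (auto simp: job_le_def)
  qed (rule bij)
  define K where "K st \<longleftrightarrow> nvar st ''n'' = n \<and> rarr st ''w'' = w' \<and>
     (\<forall>k. narr st ''ord'' (nvar st ''s'' + k) = \<sigma> (Suc k)) \<and>
     stack_inv w' n \<sigma> (narr st ''key'') (nvar st ''len'') (nvar st ''c'')" for st :: state
  \<comment> \<open>A push lowers the first summand by 2 and raises the stack by 1; a pop only
    shortens the stack.\<close>
  let ?\<mu> = "\<lambda>st::state. 2 * (n - nvar st ''c'') + nvar st ''len''"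
  have "K s3" using n3 by (simp add: K_def \<sigma>_def stack_inv_init)
  moreover have "K (post scan_body st) \<and> ?\<mu> (post scan_body st) < ?\<mu> st"
    if st: "K st" "bval st scan_cond" for st
  proof -
    have c: "nvar st ''c'' < n" using st by (simp add: K_def scan_cond_def)
    have k: "nvar st ''n'' = n" "rarr st ''w'' = w'"
      "\<And>k. narr st ''ord'' (nvar st ''s'' + k) = \<sigma> (Suc k)"
      and inv: "stack_inv w' n \<sigma> (narr st ''key'') (nvar st ''len'') (nvar st ''c'')"
      using st by (auto simp: K_def)
    show ?thesis
    proof (cases "0 < nvar st ''len'' \<and>
        \<not> w' (\<sigma> (Suc (nvar st ''c''))) < w' (narr st ''key'' (nvar st ''len'' - 1))")
      case True
      then show ?thesis using stack_inv_pop[OF inv c] k c by (simp add: K_def scan_body_def)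
    next
      case False
      then have "stack_inv w' n \<sigma> ((narr st ''key'')(nvar st ''len'' := \<sigma> (Suc (nvar st ''c''))))
          (Suc (nvar st ''len'')) (Suc (nvar st ''c''))"
        by (intro stack_inv_push[OF inv c]) blast
      then show ?thesis using False k c by (auto simp: K_def scan_body_def)
    qed
  qed
  ultimately obtain t4 s4 where 4: "exec (While scan_cond scan_body) s3 t4 s4" "K s4"
      "\<not> bval s4 scan_cond" "t4 \<le> while_time scan_cond scan_body (?\<mu> s3)"
    using exec_while[of scan_body K scan_cond ?\<mu> s3] by (auto simp: scan_body_def)
  have "nvar s4 ''c'' = n" using 4 by (auto simp: K_def scan_cond_def stack_inv_def)
  then have out: "output_list s4 = map \<sigma> (key_sequence n (\<lambda>k. w' (\<sigma> k)))"
    using 4(2) stack_inv_final[of w' n \<sigma> "narr s4 ''key''" "nvar s4 ''len''"]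
    by (simp add: K_def output_list_def)
  \<comment> \<open>Key sequences depend only on the weights at indices in \<open>{1..n}\<close>,
    where padding changes nothing.\<close>
  have "is_key_sequence n (\<lambda>k. w' (\<sigma> k)) ks \<longleftrightarrow> is_key_sequence n (\<lambda>k. w (\<sigma> k)) ks" for ks
  proof -
    have eq: "w' (\<sigma> a) = w (\<sigma> a)" if "a \<in> {1..n}" for a using \<sigma>n[OF that] by (simp add: w'_def)
    show ?thesis
    proof (cases "set ks \<subseteq> {1..n}")
      case True
      have dec: "sorted_wrt (\<lambda>a b. w' (\<sigma> a) > w' (\<sigma> b)) ks = sorted_wrt (\<lambda>a b. w (\<sigma> a) > w (\<sigma> b)) ks"
        using True eq by (intro iffI; elim sorted_wrt_mono_rel[rotated]) (metis subsetD)+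
      have nth: "ks ! j \<in> {1..n}" if "j < length ks" for j using True that nth_mem by blast
      have "(\<forall>j<length ks. \<forall>k\<in>{(0 # ks) ! j + 1 .. ks ! j}. w' (\<sigma> k) \<le> w' (\<sigma> (ks ! j))) =
        (\<forall>j<length ks. \<forall>k\<in>{(0 # ks) ! j + 1 .. ks ! j}. w (\<sigma> k) \<le> w (\<sigma> (ks ! j)))"
      proof (intro all_cong ball_cong refl)
        fix j k assume j: "j < length ks" and k: "k \<in> {(0 # ks) ! j + 1 .. ks ! j}"
        have "k \<in> {1..n}" using nth[OF j] k by auto
        then show "(w' (\<sigma> k) \<le> w' (\<sigma> (ks ! j))) = (w (\<sigma> k) \<le> w (\<sigma> (ks ! j)))"
          using eq nth[OF j] by simp
      qed
      then show ?thesis unfolding is_key_sequence_def dec by blast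
    qed (auto simp: is_key_sequence_def)
  qed
  then have "output_list s4 = key_jobs {..<n} w \<sigma>"
    using out by (simp add: key_jobs_def key_sequence_def)
  moreover have "exec key_program s0 (1 + t1 + (1 + 2 + (1 + t3 + t4))) s4"
    unfolding key_program_def by (rule exec.Seq[OF 1(1) exec.Seq[OF 2 exec.Seq[OF 3(1) 4(1)]]])
  moreover have "nvar s0 ''x'' = 0" by (simp add: s0_def input_state_def)
  \<comment> \<open>The constant 5 in \<open>key_time\<close> is one unit for each of three
    \<open>Seq\<close> nodes and two for the assignment to \<open>d\<close>.\<close>
  then have "1 + t1 + (1 + 2 + (1 + t3 + t4)) \<le> key_time n"
    using 1(4) 3(4)[unfolded m2] 4(4) n3 by (simp add: key_time_def L_def[symmetric])
  ultimately show ?thesis using idx unfolding s0_def by blast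
qed

lemma key_time_bigo: "(\<lambda>n. real (key_time n)) \<in> O(\<lambda>n. real n * ln (real n))"
proof -
  define a1 b1 where "a1 = real (1 + bcost init_cond + time_bound init_body)" and "b1 = real (1 + bcost init_cond)"
  define a2 b2 where "a2 = real (1 + bcost sort_cond + time_bound sort_body)" and "b2 = real (1 + bcost sort_cond)"
  define a3 b3 where "a3 = real (1 + bcost scan_cond + time_bound scan_body)" and "b3 = real (1 + bcost scan_cond)"
  \<comment> \<open>Replacing the ceiling by \<open>log 2 n + 1\<close> gives a smooth upper bound
    that \<open>real_asymp\<close> can handle.\<close>
  define g where "g n = 5 + (a1 * n + b1) + (a2 * ((log 2 n + 1) * (2 * n + 2) + 2 * n + 1) + b2) +
    (a3 * (2 * n) + b3)" for n :: real
  have pos: "0 \<le> a2" by (simp add: a2_def)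
  have "real (key_time n) \<le> g (real n)" if n: "1 \<le> n" for n
  proof -
    have "0 \<le> log 2 (real n)" using n by simp
    then have "real (nat \<lceil>log 2 (real n)\<rceil>) \<le> log 2 (real n) + 1" by linarith
    then have "real (nat \<lceil>log 2 (real n)\<rceil>) * (2 * real n + 2) \<le> (log 2 (real n) + 1) * (2 * real n + 2)"
      by (intro mult_right_mono) auto
    then have "a2 * (real (nat \<lceil>log 2 (real n)\<rceil>) * (2 * real n + 2) + 2 * real n + 1) \<le>
        a2 * ((log 2 (real n) + 1) * (2 * real n + 2) + 2 * real n + 1)"
      using pos by (intro mult_left_mono) auto
    moreover have "real (key_time n) = 5 + (a1 * real n + b1) +
        (a2 * (real (nat \<lceil>log 2 (real n)\<rceil>) * (2 * real n + 2) + 2 * real n + 1) + b2) + (a3 * (2 * real n) + b3)"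
      unfolding key_time_def while_time_def a1_def b1_def a2_def b2_def a3_def b3_def
      by (simp only: of_nat_add of_nat_mult of_nat_numeral of_nat_1)
    ultimately show ?thesis unfolding g_def by linarith
  qed
  then have "(\<lambda>n. real (key_time n)) \<in> O(\<lambda>n. g (real n))"
    by (intro landau_o.big_mono eventually_mono[OF eventually_ge_at_top[of 1]]) fastforce
  also have "(\<lambda>n. g (real n)) \<in> O(\<lambda>n. real n * ln (real n))"
    unfolding g_def by real_asymp
  finally show ?thesis .
qed

lemma key_sequence_computable:
  "\<exists>c T. computes_key_sequence c T \<and> (\<lambda>n. real (T n)) \<in> O(\<lambda>n. real n * ln (real n))"
  using exec_key_program key_time_bigo unfolding computes_key_sequence_def by blast

theorem theorem2:
  shows "(\<forall>(J :: 'j set) p w \<sigma>. wsps_instance J p w \<longrightarrow> job_indexing J p w \<sigma> \<longrightarrow>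
            (\<exists>S_opt. optimal J p w S_opt) \<and>
            (\<forall>S_opt. optimal J p w S_opt \<longrightarrow>
               weighted_overlap J w (key_schedule J p w \<sigma>) \<ge> 1/2 * weighted_overlap J w S_opt))
       \<and> (\<exists>c T. computes_key_sequence c T \<and>
            (\<lambda>n. real (T n)) \<in> O(\<lambda>n. real n * ln (real n)))
       \<and> (\<forall>\<epsilon>>0. \<exists>(J :: nat set) p w \<sigma> S_opt. wsps_instance J p w \<and> job_indexing J p w \<sigma> \<and>
            optimal J p w S_opt \<and>
            weighted_overlap J w (key_schedule J p w \<sigma>) < (1/2 + \<epsilon>) * weighted_overlap J w S_opt)"
proof (intro conjI allI impI)
  fix J :: "'j set" and p w \<sigma> assume inst: "wsps_instance J p w" and idx: "job_indexing J p w \<sigma>"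
  show "\<exists>S_opt. optimal J p w S_opt" by (rule optimal_exists[OF inst])
  fix S_opt assume "optimal J p w S_opt"
  then have "feasible J p S_opt" by (simp add: optimal_def)
  from key_schedule_half[OF inst idx this]
  show "weighted_overlap J w (key_schedule J p w \<sigma>) \<ge> 1/2 * weighted_overlap J w S_opt" by simp
next
  show "\<exists>c T. computes_key_sequence c T \<and> (\<lambda>n. real (T n)) \<in> O(\<lambda>n. real n * ln (real n))"
    by (rule key_sequence_computable)
next
  fix \<epsilon> :: real assume "0 < \<epsilon>"
  then show "\<exists>(J :: nat set) p w \<sigma> S_opt. wsps_instance J p w \<and> job_indexing J p w \<sigma> \<and>
      optimal J p w S_opt \<and>
      weighted_overlap J w (key_schedule J p w \<sigma>) < (1/2 + \<epsilon>) * weighted_overlap J w S_opt"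
    by (rule key_schedule_tight)
qed

end
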